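(* Let $r\le s$ and let $A\in\mathbb{C}_r^{m\times n}$, $\widetilde A=A+E\in\mathbb{C}_s^{m\times n}$ have the generalized polar decompositions $A=QH$ and $\widetilde A=\widetilde Q\widetilde H$. Then $$\|H-\widetilde H\|_F\le\sqrt{\frac{F_{r,s}-\sqrt{F_{r,s}^2-2G_{r,r}F_{r,s}}}{G_{r,r}}}\;\|E\|_F,$$ where $F_{r,s}:=\sum_{j=1}^r\sigma_j^2+\sum_{j=1}^s\widetilde\sigma_j^2$, $G_{r,r}:=\sum_{j=1}^r\sigma_j\widetilde\sigma_j$, and the coefficient is optimal.
   Context: $\mathbb{C}^{m\times n}$ is the set of complex $m\times n$ matrices and $\mathbb{C}_r^{m\times n}$ is the subset of those of rank $r$; $\|\cdot\|_F$ is the Frobenius norm; $A^*$ is the conjugate transpose of $A$ and $|A|:=(A^*A)^{1/2}$. For $A\in\mathbb{C}_r^{m\times n}$, the generalized polar decomposition is $A=QH$ with $Q\in\mathbb{C}_r^{m\times n}$ subunitary (a partial isometry) and $H\in\mathbb{C}_r^{n\times n}$ positive semidefinite; it is unique under the condition $\mathcal R(Q^* )=\mathcal R(H)$ (where $\mathcal R$ denotes the column space), and then $H=|A|$ and $\widetilde H=|\widetilde A|$. $Q$ is the subunitary polar factor and $H$ the positive polar factor. The nonzero singular values of $A$ and $\widetilde A$, in decreasing order, are $\sigma_1\ge\dots\ge\sigma_r>0$ and $\widetilde\sigma_1\ge\dots\ge\widetilde\sigma_s>0$, respectively. *)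

theory Defs
  imports "Jordan_Normal_Form.Schur_Decomposition"
    "Jordan_Normal_Form.Char_Poly" "Jordan_Normal_Form.DL_Rank"
begin

text \<open>The set of complex m by n matrices of rank r. The locale parameter of
  \<^const>\<open>vec_space.rank\<close> is the length of the columns.\<close>

definition rank_carrier_mat :: "nat \<Rightarrow> nat \<Rightarrow> nat \<Rightarrow> complex mat set" where
  "rank_carrier_mat r m n = {A \<in> carrier_mat m n. vec_space.rank m A = r}"

definition frob_norm :: "complex mat \<Rightarrow> real" where
  "frob_norm A = sqrt (\<Sum>i<dim_row A. \<Sum>j<dim_col A. (cmod (A $$ (i, j)))\<^sup>2)"

definition pos_semidef :: "complex mat \<Rightarrow> bool" where
  "pos_semidef H \<longleftrightarrow>
     H \<in> carrier_mat (dim_row H) (dim_row H) \<and> mat_adjoint H = H \<and>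
     (\<forall>x \<in> carrier_vec (dim_row H). 0 \<le> Re ((H *\<^sub>v x) \<bullet>c x))"

text \<open>A partial isometry: it preserves the norm on the column space of its adjoint,
  that is, on the orthogonal complement of its kernel.\<close>

definition subunitary :: "complex mat \<Rightarrow> bool" where
  "subunitary Q \<longleftrightarrow>
     (\<forall>x \<in> vec_space.col_space (dim_col Q) (mat_adjoint Q).
        (Q *\<^sub>v x) \<bullet>c (Q *\<^sub>v x) = x \<bullet>c x)"

text \<open>The last conjunct is the condition that makes the decomposition unique.\<close>

definition gen_polar_decomp ::
    "nat \<Rightarrow> nat \<Rightarrow> nat \<Rightarrow> complex mat \<Rightarrow> complex mat \<Rightarrow> complex mat \<Rightarrow> bool" where
  "gen_polar_decomp r m n A Q H \<longleftrightarrow>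
     Q \<in> rank_carrier_mat r m n \<and> subunitary Q \<and>
     H \<in> rank_carrier_mat r n n \<and> pos_semidef H \<and>
     A = Q * H \<and>
     vec_space.col_space n (mat_adjoint Q) = vec_space.col_space n H"

text \<open>The nonzero singular values with multiplicity, in decreasing order: the square roots of
  the nonzero roots of the characteristic polynomial of the Gram matrix. These roots are real and
  nonnegative, so taking the real part loses nothing. The list is indexed from 0.\<close>

definition sing_vals :: "complex mat \<Rightarrow> real list" where
  "sing_vals A = rev (sorted_list_of_multiset
     (image_mset (\<lambda>z. sqrt (Re z))
       (filter_mset (\<lambda>z. z \<noteq> 0) (proots (char_poly (mat_adjoint A * A))))))"

definition F_sum :: "nat \<Rightarrow> nat \<Rightarrow> complex mat \<Rightarrow> complex mat \<Rightarrow> real" where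
  "F_sum r s A B = (\<Sum>j<r. (sing_vals A ! j)\<^sup>2) + (\<Sum>j<s. (sing_vals B ! j)\<^sup>2)"

definition G_sum :: "nat \<Rightarrow> complex mat \<Rightarrow> complex mat \<Rightarrow> real" where
  "G_sum r A B = (\<Sum>j<r. sing_vals A ! j * sing_vals B ! j)"

definition polar_coeff :: "nat \<Rightarrow> nat \<Rightarrow> complex mat \<Rightarrow> complex mat \<Rightarrow> real" where
  "polar_coeff r s A B =
     sqrt ((F_sum r s A B - sqrt ((F_sum r s A B)\<^sup>2 - 2 * G_sum r A B * F_sum r s A B))
           / G_sum r A B)"

end

theory Submission
  imports Defs
begin

text \<open>
The proof compares two real inner products for the Frobenius norm, written for \<open>B = A + E\<close> as
\<open>x = Re \<langle>A, B\<rangle>\<close> and \<open>y = Re \<langle>H, Ht\<rangle>\<close>. A matrix and its positive polar factor have the same Frobenius norm, so that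
the squared norms of \<open>E\<close> and \<open>H - Ht\<close> are \<open>F - 2 x\<close> and \<open>F - 2 y\<close>. With \<open>c\<close> the square of the coefficient,
the claim is therefore \<open>F - 2 y \<le> c (F - 2 x)\<close>.

Singular value expansions \<open>A = \<Sum> \<sigma>\<^sub>i p\<^sub>i u\<^sub>i\<^sup>*\<close>, \<open>H = \<Sum> \<sigma>\<^sub>i u\<^sub>i u\<^sub>i\<^sup>*\<close> and \<open>B = \<Sum> \<tau>\<^sub>j q\<^sub>j v\<^sub>j\<^sup>*\<close>, \<open>Ht = \<Sum> \<tau>\<^sub>j v\<^sub>j v\<^sub>j\<^sup>*\<close>
(lemma \<open>gen_polar_decomp_expansion\<close>) turn \<open>x\<close> and \<open>y\<close> into the sums over \<open>i\<close> and \<open>j\<close> of \<open>\<sigma>\<^sub>i \<tau>\<^sub>j\<close> times the real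
part of \<open>\<langle>p\<^sub>i, q\<^sub>j\<rangle>\<close> times the conjugate of \<open>\<langle>u\<^sub>i, v\<^sub>j\<rangle>\<close>, and of \<open>\<sigma>\<^sub>i \<tau>\<^sub>j\<close> times the squared modulus of \<open>\<langle>u\<^sub>i, v\<^sub>j\<rangle>\<close>. The squared moduli of
the \<open>\<langle>p\<^sub>i, q\<^sub>j\<rangle>\<close> form a doubly substochastic matrix, so their sum with the weights \<open>\<sigma>\<^sub>i \<tau>\<^sub>j\<close> is at most \<open>G\<close>
(lemma \<open>substochastic_weighted_sum_le\<close>). The inequality between arithmetic and geometric mean for each pair
gives \<open>2 c x \<le> 2 y + c\<^sup>2 G / 2\<close> (lemma \<open>inner_products_trade_off\<close>). Finally
\<open>c\<close> is a root of \<open>G c\<^sup>2 - 2 F c + 2 F\<close>, so that \<open>c\<^sup>2 G / 2 = (c - 1) F\<close>, which is exactly the claim.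

Equality requires \<open>x = t G\<close> and \<open>y = t\<^sup>2 G\<close> with \<open>t = c / 2\<close>. Taking equal left singular vectors
and turning all right singular vectors by one common angle with cosine \<open>t\<close> realizes these values
for every \<open>t\<close> between 0 and 1 (lemma \<open>extremal_pair\<close>). If \<open>c < 2\<close>, the choice
\<open>t = c / 2\<close> attains the bound; if \<open>c = 2\<close>, which forces \<open>F = 2 G\<close>, the bound is only approached as \<open>t\<close> tends to 1.
\<close>

section \<open>Adjoints, diagonal and unitary matrices\<close>

lemma dim_mat_adjoint [simp]:
  "dim_row (mat_adjoint A) = dim_col A" "dim_col (mat_adjoint A) = dim_row A"
  by (auto simp: mat_adjoint_def)

lemma mat_adjoint_carrier [simp]: "mat_adjoint A \<in> carrier_mat n m \<longleftrightarrow> A \<in> carrier_mat m n"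
  unfolding carrier_mat_def by auto

text \<open>For square matrices the inner dimension occurs in the conclusion, so that the simplifier need not
guess it in nested products.\<close>

lemma square_mult_carrier [simp]:
  "A \<in> carrier_mat n n \<Longrightarrow> B \<in> carrier_mat n n \<Longrightarrow> A * B \<in> carrier_mat n n"
  by (rule mult_carrier_mat)

lemma index_mat_adjoint [simp]:
  fixes A :: "complex mat"
  assumes "i < dim_col A" "j < dim_row A"
  shows "mat_adjoint A $$ (i, j) = cnj (A $$ (j, i))"
  using assms by (simp add: mat_adjoint_def mat_of_rows_def)

lemma mat_adjoint_adjoint [simp]: "mat_adjoint (mat_adjoint A) = (A :: complex mat)"
  by (rule eq_matI) auto

lemma index_mult_mat_sum:
  fixes A B :: "complex mat"
  assumes "A \<in> carrier_mat m k" "B \<in> carrier_mat k n" "i < m" "j < n"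
  shows "(A * B) $$ (i, j) = (\<Sum>l<k. A $$ (i, l) * B $$ (l, j))"
  using assms by (auto simp: scalar_prod_def lessThan_atLeast0 intro!: sum.cong)

lemma mat_adjoint_mult:
  fixes A B :: "complex mat"
  assumes A: "A \<in> carrier_mat m k" and B: "B \<in> carrier_mat k n"
  shows "mat_adjoint (A * B) = mat_adjoint B * mat_adjoint A"
proof (rule eq_matI)
  fix i j assume "i < dim_row (mat_adjoint B * mat_adjoint A)" "j < dim_col (mat_adjoint B * mat_adjoint A)"
  then have ij: "i < n" "j < m" using A B by auto
  have "(mat_adjoint B * mat_adjoint A) $$ (i, j) = (\<Sum>l<k. mat_adjoint B $$ (i, l) * mat_adjoint A $$ (l, j))"
    by (rule index_mult_mat_sum) (use A B ij in auto)
  also have "\<dots> = (\<Sum>l<k. cnj (A $$ (j, l) * B $$ (l, i)))"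
    using A B ij by (auto intro!: sum.cong)
  also have "\<dots> = cnj ((A * B) $$ (j, i))"
    by (subst index_mult_mat_sum[OF A B]) (use ij in auto)
  finally show "mat_adjoint (A * B) $$ (i, j) = (mat_adjoint B * mat_adjoint A) $$ (i, j)"
    using A B ij by simp
qed (use A B in auto)

definition diagonal :: "nat \<Rightarrow> (nat \<Rightarrow> complex) \<Rightarrow> complex mat" where
  "diagonal n f = mat n n (\<lambda>(i, j). if i = j then f i else 0)"

lemma diagonal_carrier [simp]: "diagonal n f \<in> carrier_mat n n"
  and dim_diagonal [simp]: "dim_row (diagonal n f) = n" "dim_col (diagonal n f) = n"
  and index_diagonal [simp]: "i < n \<Longrightarrow> j < n \<Longrightarrow> diagonal n f $$ (i, j) = (if i = j then f i else 0)"
  by (auto simp: diagonal_def)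

lemma diagonal_cong: "(\<And>i. i < n \<Longrightarrow> f i = g i) \<Longrightarrow> diagonal n f = diagonal n g"
  by (auto simp: diagonal_def intro!: eq_matI)

lemma mat_adjoint_diagonal: "mat_adjoint (diagonal n f) = diagonal n (\<lambda>i. cnj (f i))"
  by (rule eq_matI) auto

lemma index_mult_diagonal:
  assumes "A \<in> carrier_mat m n" "i < m" "j < n"
  shows "(A * diagonal n f) $$ (i, j) = A $$ (i, j) * f j"
proof -
  have "(A * diagonal n f) $$ (i, j) = (\<Sum>l<n. A $$ (i, l) * diagonal n f $$ (l, j))"
    by (rule index_mult_mat_sum) (use assms in auto)
  also have "\<dots> = (\<Sum>l<n. if l = j then A $$ (i, l) * f l else 0)"
    using assms by (intro sum.cong) auto
  finally show ?thesis using assms by simp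
qed

lemma index_diagonal_mult:
  assumes "A \<in> carrier_mat n m" "i < n" "j < m"
  shows "(diagonal n f * A) $$ (i, j) = f i * A $$ (i, j)"
proof -
  have "(diagonal n f * A) $$ (i, j) = (\<Sum>l<n. diagonal n f $$ (i, l) * A $$ (l, j))"
    by (rule index_mult_mat_sum) (use assms in auto)
  also have "\<dots> = (\<Sum>l<n. if l = i then f i * A $$ (l, j) else 0)"
    using assms by (intro sum.cong) auto
  finally show ?thesis using assms by simp
qed

lemma diagonal_mult_diagonal: "diagonal n f * diagonal n g = diagonal n (\<lambda>i. f i * g i)"
  by (rule eq_matI) (auto simp: index_mult_diagonal[of _ n] simp del: index_mult_mat(1))

definition unitary_mat :: "nat \<Rightarrow> complex mat \<Rightarrow> bool" where
  "unitary_mat n U \<longleftrightarrow> U \<in> carrier_mat n n \<and> mat_adjoint U * U = 1\<^sub>m n"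

lemma unitary_matD:
  assumes "unitary_mat n U"
  shows "U \<in> carrier_mat n n" "mat_adjoint U * U = 1\<^sub>m n" "U * mat_adjoint U = 1\<^sub>m n"
  using assms mat_mult_left_right_inverse[of "mat_adjoint U" n U] by (auto simp: unitary_mat_def)

lemma unitary_mat_columns:
  assumes "unitary_mat n U" "i < n" "j < n"
  shows "(\<Sum>a<n. U $$ (a, i) * cnj (U $$ (a, j))) = (if i = j then 1 else 0)"
proof -
  have "(\<Sum>a<n. U $$ (a, i) * cnj (U $$ (a, j))) = (\<Sum>a<n. mat_adjoint U $$ (j, a) * U $$ (a, i))"
    using assms unitary_matD(1)[OF assms(1)] by (intro sum.cong) auto
  also have "\<dots> = (mat_adjoint U * U) $$ (j, i)"
    by (rule index_mult_mat_sum[symmetric]) (use assms unitary_matD(1)[OF assms(1)] in auto)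
  finally show ?thesis using assms unitary_matD(2)[OF assms(1)] by auto
qed

lemma unitary_mat_mult:
  assumes "unitary_mat n U" "unitary_mat n V"
  shows "unitary_mat n (U * V)"
proof -
  note [simp] = unitary_matD(1)[OF assms(1)] unitary_matD(1)[OF assms(2)]
  have "mat_adjoint (U * V) * (U * V) = (mat_adjoint V * mat_adjoint U) * (U * V)"
    by (subst mat_adjoint_mult[of _ n n _ n]) auto
  also have "\<dots> = mat_adjoint V * ((mat_adjoint U * U) * V)"
    by (simp add: assoc_mult_mat[of _ n n _ n _ n])
  also have "\<dots> = 1\<^sub>m n"
    by (simp only: unitary_matD[OF assms(1)] unitary_matD[OF assms(2)]
        left_mult_one_mat[OF unitary_matD(1)[OF assms(2)]])
  finally show ?thesis by (simp add: unitary_mat_def)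
qed

lemma unitary_mat_adjoint:
  assumes "unitary_mat n U"
  shows "unitary_mat n (mat_adjoint U)"
  using unitary_matD(1,3)[OF assms] by (simp add: unitary_mat_def)

text \<open>Completing a vector to a basis, Gram-Schmidt, and scaling each column to length one.\<close>

lemma unitary_with_first_column:
  assumes v: "v \<in> carrier_vec n" and v0: "v \<noteq> 0\<^sub>v n"
  shows "\<exists>W c. unitary_mat n W \<and> col W 0 = c \<cdot>\<^sub>v (v :: complex vec) \<and> 0 < n"
proof -
  interpret cof_vec_space n "TYPE(complex)" .
  define ws where "ws = gram_schmidt n (basis_completion v)"
  note b = basis_completion[OF v v0]
  have n0: "0 < n" using v v0 by (metis gr0I zero_carrier_vec vec_of_dim_0 carrier_vecD)
  obtain vs where bv: "basis_completion v = v # vs"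
    using b(6,7) n0 by (cases "basis_completion v") auto
  note gs = gram_schmidt_result[OF b(2,4,5) refl, folded ws_def]
  have len: "length ws = n" using gs(4) b(6) by simp
  have hd: "ws ! 0 = v" using gram_schmidt_hd[OF v, of vs] len n0
    unfolding ws_def bv by (metis hd_conv_nth length_0_conv less_numeral_extra(3))
  define N where "N i = (\<Sum>a<n. (cmod (ws ! i $ a))\<^sup>2)" for i
  have wsc: "ws ! i \<in> carrier_vec n" if "i < n" for i using gs(3) len that by auto
  have ip: "(ws ! i) \<bullet>c (ws ! j) = (\<Sum>a<n. ws ! i $ a * cnj (ws ! j $ a))" if "i < n" "j < n" for i j
    using wsc[OF that(1)] wsc[OF that(2)] by (auto simp: scalar_prod_def lessThan_atLeast0 intro!: sum.cong)
  have self: "(ws ! i) \<bullet>c (ws ! i) = of_real (N i)" if "i < n" for i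
    unfolding ip[OF that that] N_def of_real_sum by (intro sum.cong refl) (simp only: complex_norm_square)
  have orth: "(ws ! i) \<bullet>c (ws ! j) = 0 \<longleftrightarrow> i \<noteq> j" if "i < n" "j < n" for i j
    by (rule corthogonalD[OF gs(2)]) (use len that in simp_all)
  have Npos: "N i > 0" if "i < n" for i
  proof -
    have "N i \<noteq> 0" using self[OF that] orth[OF that that] by (metis of_real_0)
    moreover have "N i \<ge> 0" unfolding N_def by (intro sum_nonneg) auto
    ultimately show ?thesis by simp
  qed
  define W where "W = mat n n (\<lambda>(a, i). ws ! i $ a / of_real (sqrt (N i)))"
  have Wc [simp]: "W \<in> carrier_mat n n" by (simp add: W_def)
  have "mat_adjoint W * W = 1\<^sub>m n"
  proof (rule eq_matI)
    fix i j assume "i < dim_row (1\<^sub>m n :: complex mat)" "j < dim_col (1\<^sub>m n :: complex mat)"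
    then have ij: "i < n" "j < n" by auto
    have "(mat_adjoint W * W) $$ (i, j) = (\<Sum>a<n. mat_adjoint W $$ (i, a) * W $$ (a, j))"
      by (rule index_mult_mat_sum) (use ij in auto)
    also have "\<dots> = (\<Sum>a<n. ws ! j $ a * cnj (ws ! i $ a) / (of_real (sqrt (N i)) * of_real (sqrt (N j))))"
      using ij Wc by (intro sum.cong refl) (auto simp: W_def)
    also have "\<dots> = (ws ! j) \<bullet>c (ws ! i) / (of_real (sqrt (N i)) * of_real (sqrt (N j)))"
      unfolding ip[OF ij(2,1)] sum_divide_distrib ..
    also have "\<dots> = (if i = j then 1 else 0)"
    proof (cases "i = j")
      case True
      have "of_real (sqrt (N i)) * of_real (sqrt (N i)) = (of_real (N i) :: complex)"
        using Npos[OF ij(1)] by (simp flip: of_real_mult)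
      then show ?thesis using True self[OF ij(1)] Npos[OF ij(1)] by simp
    qed (use orth[OF ij(2,1)] in auto)
    finally show "(mat_adjoint W * W) $$ (i, j) = 1\<^sub>m n $$ (i, j)" using ij by simp
  qed (auto simp: W_def)
  moreover have "col W 0 = (1 / of_real (sqrt (N 0))) \<cdot>\<^sub>v v"
    by (rule eq_vecI) (use n0 v hd in \<open>auto simp: W_def\<close>)
  ultimately show ?thesis using n0 Wc unfolding unitary_mat_def by blast
qed

section \<open>Unitary diagonalization of Hermitian matrices\<close>

lemma hermitian_conjugate:
  fixes A W :: "complex mat"
  assumes "A \<in> carrier_mat n n" "mat_adjoint A = A" "W \<in> carrier_mat n n"
  shows "mat_adjoint (mat_adjoint W * A * W) = mat_adjoint W * A * W"
  using assms by (simp add: mat_adjoint_mult[of _ n n _ n] assoc_mult_mat[of _ n n _ n _ n])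

lemma unitary_conjugate_cancel:
  assumes "A \<in> carrier_mat n n" "unitary_mat n W"
  shows "W * (mat_adjoint W * A * W) * mat_adjoint W = A"
proof -
  note [simp] = assms(1) unitary_matD(1)[OF assms(2)]
  have "W * (mat_adjoint W * A * W) * mat_adjoint W = (W * mat_adjoint W) * A * (W * mat_adjoint W)"
    by (simp add: assoc_mult_mat[of _ n n _ n _ n])
  then show ?thesis
    by (simp add: unitary_matD(3)[OF assms(2)] left_mult_one_mat[OF assms(1)] right_mult_one_mat[OF assms(1)])
qed

lemma char_poly_unitary_conjugate:
  assumes "A \<in> carrier_mat n n" "unitary_mat n W"
  shows "char_poly (W * A * mat_adjoint W) = char_poly A"
  by (rule char_poly_similar) (unfold similar_mat_def, intro exI, rule similar_mat_witI[of W "mat_adjoint W" n],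
      use assms unitary_matD[OF assms(2)] in simp_all)

text \<open>The induction deflates: an eigenvector is completed to a unitary matrix, and
in the new basis the matrix is block diagonal because it is Hermitian, which makes the first row
vanish together with the first column. The list of eigenvalues is given in advance so that its
order can be chosen freely.\<close>

theorem spectral_theorem:
  assumes "A \<in> carrier_mat n n" "mat_adjoint A = A"
    and "char_poly A = (\<Prod>e\<leftarrow>es. [:- e, 1:])"
  shows "\<exists>U. unitary_mat n U \<and> A = U * diagonal n (\<lambda>i. es ! i) * mat_adjoint U"
  using assms
proof (induction es arbitrary: n A)
  case Nil
  then have "n = 0" using degree_monic_char_poly[of A n] by auto
  then show ?case using Nil by (intro exI[of _ "1\<^sub>m 0"]) (auto simp: unitary_mat_def intro!: eq_matI)
next
  case (Cons e es)
  note A = Cons.prems(1)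
  have "eigenvalue A e"
    unfolding eigenvalue_root_char_poly[OF A] Cons.prems(3) by simp
  from find_eigenvector[OF A this] obtain v where v: "v \<in> carrier_vec n" "v \<noteq> 0\<^sub>v n" "A *\<^sub>v v = e \<cdot>\<^sub>v v"
    using A unfolding eigenvector_def by auto
  obtain W c where W: "unitary_mat n W" and W0: "col W 0 = c \<cdot>\<^sub>v v" and n0: "0 < n"
    using unitary_with_first_column[OF v(1,2)] by blast
  note Wc [simp] = unitary_matD(1)[OF W]
  note [simp] = A carrier_matD[OF A] carrier_matD[OF Wc]
  define m where "m = n - 1"
  have nm: "n = Suc m" using n0 by (simp add: m_def)
  define A' where "A' = mat_adjoint W * A * W"
  have A'c [simp]: "A' \<in> carrier_mat n n" by (simp add: A'_def)
  note [simp] = carrier_matD[OF A'c]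
  have A'h: "mat_adjoint A' = A'" unfolding A'_def
    by (rule hermitian_conjugate[OF A Cons.prems(2) Wc])
  have AW: "col (A * W) 0 = e \<cdot>\<^sub>v col W 0"
  proof -
    have "col (A * W) 0 = A *\<^sub>v col W 0" using n0 by (intro col_mult2[of _ n n _ n]) auto
    also have "\<dots> = e \<cdot>\<^sub>v col W 0" unfolding W0
      using v mult_mat_vec[OF A v(1), of c] by (simp add: smult_smult_assoc mult.commute)
    finally show ?thesis .
  qed
  have col0: "A' $$ (i, 0) = (if i = 0 then e else 0)" if "i < n" for i
  proof -
    have "A' = mat_adjoint W * (A * W)" unfolding A'_def by (simp add: assoc_mult_mat[of _ n n _ n _ n])
    then have "A' $$ (i, 0) = row (mat_adjoint W) i \<bullet> col (A * W) 0" using that n0 by simp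
    also have "\<dots> = e * (row (mat_adjoint W) i \<bullet> col W 0)" unfolding AW
      by (subst scalar_prod_smult_right) (use that n0 in auto)
    also have "row (mat_adjoint W) i \<bullet> col W 0 = (mat_adjoint W * W) $$ (i, 0)"
      using that n0 by (subst index_mult_mat) auto
    finally show ?thesis using unitary_matD(2)[OF W] that n0 by simp
  qed
  have row0: "A' $$ (0, i) = (if i = 0 then e else 0)" if "i < n" for i
  proof (cases "i = 0")
    case False
    have "A' $$ (0, i) = mat_adjoint A' $$ (0, i)" using A'h by simp
    also have "\<dots> = cnj (A' $$ (i, 0))" using that n0 A'c by (intro index_mat_adjoint) auto
    finally show ?thesis using col0[OF that] False by simp
  qed (use col0[OF n0] in auto)
  \<comment> \<open>The matrix that remains after deflation.\<close>
  define A3 where "A3 = mat m m (\<lambda>(i, j). A' $$ (Suc i, Suc j))"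
  have A3c [simp]: "A3 \<in> carrier_mat m m" by (simp add: A3_def)
  have blk: "A' = four_block_mat (mat 1 1 (\<lambda>_. e)) (0\<^sub>m 1 m) (0\<^sub>m m 1) A3"
    by (rule eq_matI) (use A'c nm in \<open>auto simp: col0 row0 A3_def four_block_mat_def Let_def\<close>)
  have "[:- e, 1:] * (\<Prod>e\<leftarrow>es. [:- e, 1:]) = char_poly A" using Cons.prems(3) by simp
  also have "\<dots> = char_poly A'"
    using char_poly_unitary_conjugate[OF A'c W] unitary_conjugate_cancel[OF A W] by (simp add: A'_def)
  also have "\<dots> = char_poly (mat 1 1 (\<lambda>_. e)) * char_poly A3"
    unfolding blk by (rule char_poly_four_block_zeros_col) auto
  also have "char_poly (mat 1 1 (\<lambda>_. e)) = [:- e, 1:]"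
    by (simp add: char_poly_defs det_def sign_def)
  finally have cp3: "char_poly A3 = (\<Prod>e\<leftarrow>es. [:- e, 1:])"
    by (metis mult_cancel_left pCons_eq_0_iff zero_neq_one)
  have A3h: "mat_adjoint A3 = A3"
  proof (rule eq_matI)
    fix i j assume "i < dim_row A3" "j < dim_col A3"
    then have ij: "Suc i < n" "Suc j < n" using nm by (auto simp: A3_def)
    have "mat_adjoint A3 $$ (i, j) = cnj (A' $$ (Suc j, Suc i))" using ij nm by (auto simp: A3_def)
    also have "\<dots> = mat_adjoint A' $$ (Suc i, Suc j)" using ij A'c by (intro index_mat_adjoint[symmetric]) auto
    finally show "mat_adjoint A3 $$ (i, j) = A3 $$ (i, j)" using ij nm unfolding A'h by (auto simp: A3_def)
  qed (auto simp: A3_def)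
  obtain U3 where U3: "unitary_mat m U3" and A3: "A3 = U3 * diagonal m (\<lambda>i. es ! i) * mat_adjoint U3"
    using Cons.IH[OF A3c A3h cp3] by blast
  note U3c [simp] = unitary_matD(1)[OF U3]
  note [simp] = carrier_matD[OF U3c]
  define B where "B = four_block_mat (1\<^sub>m 1) (0\<^sub>m 1 m) (0\<^sub>m m 1) U3"
  have B: "B \<in> carrier_mat n n" unfolding B_def nm by (rule four_block_carrier_mat[of _ 1 1, simplified]) auto
  have Bad: "mat_adjoint B = four_block_mat (1\<^sub>m 1) (0\<^sub>m 1 m) (0\<^sub>m m 1) (mat_adjoint U3)"
    by (rule eq_matI) (use U3c in \<open>auto simp: B_def four_block_mat_def Let_def\<close>)
  have D: "diagonal n (\<lambda>i. (e # es) ! i)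
      = four_block_mat (mat 1 1 (\<lambda>_. e)) (0\<^sub>m 1 m) (0\<^sub>m m 1) (diagonal m (\<lambda>i. es ! i))"
    by (rule eq_matI) (use nm in \<open>auto simp: four_block_mat_def Let_def nth_Cons'\<close>)
  have "mat_adjoint B * B = four_block_mat (1\<^sub>m 1) (0\<^sub>m 1 m) (0\<^sub>m m 1) (1\<^sub>m m)"
    unfolding Bad unfolding B_def
    by (subst mult_four_block_mat[where ?nr1.0 = 1 and ?n1.0 = 1 and ?n2.0 = m and ?nr2.0 = m and ?nc1.0 = 1 and ?nc2.0 = m])
      (use unitary_matD(2)[OF U3] in auto)
  also have "\<dots> = 1\<^sub>m n" by (rule eq_matI) (use nm in \<open>auto simp: four_block_mat_def Let_def\<close>)
  finally have uB: "unitary_mat n B" using B by (simp add: unitary_mat_def)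
  have "B * diagonal n (\<lambda>i. (e # es) ! i)
      = four_block_mat (mat 1 1 (\<lambda>_. e)) (0\<^sub>m 1 m) (0\<^sub>m m 1) (U3 * diagonal m (\<lambda>i. es ! i))"
    unfolding D unfolding B_def
    by (subst mult_four_block_mat[where ?nr1.0 = 1 and ?n1.0 = 1 and ?n2.0 = m and ?nr2.0 = m and ?nc1.0 = 1 and ?nc2.0 = m]) auto
  then have A'eq: "B * diagonal n (\<lambda>i. (e # es) ! i) * mat_adjoint B = A'"
    unfolding Bad blk A3
    by (simp, subst mult_four_block_mat[where ?nr1.0 = 1 and ?n1.0 = 1 and ?n2.0 = m and ?nr2.0 = m and ?nc1.0 = 1 and ?nc2.0 = m]) auto
  have "A = W * A' * mat_adjoint W" using unitary_conjugate_cancel[OF A W] by (simp add: A'_def)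
  also have "\<dots> = (W * B) * diagonal n (\<lambda>i. (e # es) ! i) * mat_adjoint (W * B)"
    unfolding A'eq[symmetric] using B
    by (simp add: assoc_mult_mat[of _ n n _ n _ n] mat_adjoint_mult[of _ n n _ n])
  finally show ?case using unitary_mat_mult[OF W uB] by blast
qed

section \<open>Rank, column space and singular values from a diagonalization\<close>

lemma rank_cong_col_space:
  assumes "vec_space.col_space n A = vec_space.col_space n B"
  shows "vec_space.rank n A = vec_space.rank n (B :: complex mat)"
proof -
  interpret vec_space "TYPE(complex)" n .
  show ?thesis using assms unfolding rank_def col_space_def by simp
qed

lemma index_mult_mat_vec_sum:
  assumes "A \<in> carrier_mat m n" "x \<in> carrier_vec n" "i < m"
  shows "(A *\<^sub>v x) $ i = (\<Sum>l<n. A $$ (i, l) * x $ l)"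
  using assms by (auto simp: scalar_prod_def lessThan_atLeast0 intro!: sum.cong)

lemma index_diagonal_mult_vec:
  assumes "y \<in> carrier_vec n" "i < n"
  shows "(diagonal n f *\<^sub>v y) $ i = f i * y $ i"
proof -
  have "(diagonal n f *\<^sub>v y) $ i = (\<Sum>l<n. diagonal n f $$ (i, l) * y $ l)"
    by (rule index_mult_mat_vec_sum) (use assms in auto)
  also have "\<dots> = (\<Sum>l<n. if l = i then f i * y $ l else 0)" using assms by (intro sum.cong) auto
  finally show ?thesis using assms by simp
qed

definition coord_subspace :: "nat \<Rightarrow> nat \<Rightarrow> complex vec set" where
  "coord_subspace n k = {z \<in> carrier_vec n. \<forall>i. k \<le> i \<longrightarrow> i < n \<longrightarrow> z $ i = 0}"

text \<open>The unitary factor on the right maps onto the whole space, and the diagonal factor maps onto the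
first coordinates, where it is invertible; only the left factor remains visible in the range.\<close>

lemma col_space_mult_coord_subspace:
  assumes P: "P \<in> carrier_mat m n" and U: "unitary_mat n U"
    and f: "\<And>i. i < n \<Longrightarrow> f i \<noteq> 0 \<longleftrightarrow> i < k"
  shows "vec_space.col_space m (P * diagonal n f * mat_adjoint U) = (\<lambda>z. P *\<^sub>v z) ` coord_subspace n k"
proof -
  note Uc = unitary_matD(1)[OF U]
  have M: "P * diagonal n f * mat_adjoint U \<in> carrier_mat m n"
    using P Uc by (intro mult_carrier_mat[of _ m n]) auto
  have eq: "P * diagonal n f * mat_adjoint U *\<^sub>v x = P *\<^sub>v (diagonal n f *\<^sub>v (mat_adjoint U *\<^sub>v x))"
    if "x \<in> carrier_vec n" for x
  proof -
    have c: "mat_adjoint U \<in> carrier_mat n n" "mat_adjoint U *\<^sub>v x \<in> carrier_vec n"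
      using Uc that by (auto intro!: mult_mat_vec_carrier)
    have "P * diagonal n f * mat_adjoint U *\<^sub>v x = P * diagonal n f *\<^sub>v (mat_adjoint U *\<^sub>v x)"
      by (rule assoc_mult_mat_vec[of _ m n _ n]) (use P c that in \<open>auto intro!: mult_carrier_mat[of _ m n]\<close>)
    also have "\<dots> = P *\<^sub>v (diagonal n f *\<^sub>v (mat_adjoint U *\<^sub>v x))"
      by (rule assoc_mult_mat_vec[of _ m n _ n]) (use P c in auto)
    finally show ?thesis .
  qed
  show ?thesis
  proof (intro equalityI subsetI)
    fix y assume "y \<in> vec_space.col_space m (P * diagonal n f * mat_adjoint U)"
    then obtain x where x: "x \<in> carrier_vec n" "y = P * diagonal n f * mat_adjoint U *\<^sub>v x"
      unfolding vec_space.col_space_eq[OF M] using M by auto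
    have c: "mat_adjoint U *\<^sub>v x \<in> carrier_vec n" using Uc x by (intro mult_mat_vec_carrier[of _ n n]) auto
    have "diagonal n f *\<^sub>v (mat_adjoint U *\<^sub>v x) \<in> coord_subspace n k"
      unfolding coord_subspace_def
    proof (intro CollectI conjI allI impI)
      show "diagonal n f *\<^sub>v (mat_adjoint U *\<^sub>v x) \<in> carrier_vec n"
        by (rule mult_mat_vec_carrier[OF _ c]) simp
      fix i assume "k \<le> i" "i < n"
      then show "(diagonal n f *\<^sub>v (mat_adjoint U *\<^sub>v x)) $ i = 0"
        unfolding index_diagonal_mult_vec[OF c \<open>i < n\<close>] using f[of i] by auto
    qed
    then show "y \<in> (\<lambda>z. P *\<^sub>v z) ` coord_subspace n k" using eq[OF x(1)] x(2) by auto
  next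
    fix y assume "y \<in> (\<lambda>z. P *\<^sub>v z) ` coord_subspace n k"
    then obtain z where z: "z \<in> carrier_vec n" "\<And>i. k \<le> i \<Longrightarrow> i < n \<Longrightarrow> z $ i = 0" "y = P *\<^sub>v z"
      unfolding coord_subspace_def by auto
    define w where "w = vec n (\<lambda>i. z $ i / f i)"
    have w: "w \<in> carrier_vec n" by (simp add: w_def)
    define x where "x = U *\<^sub>v w"
    have x: "x \<in> carrier_vec n" unfolding x_def using Uc w by (intro mult_mat_vec_carrier[of _ n n]) auto
    have "mat_adjoint U *\<^sub>v x = (mat_adjoint U * U) *\<^sub>v w"
      unfolding x_def by (rule assoc_mult_mat_vec[symmetric, of _ n n _ n]) (use Uc w in auto)
    also have "\<dots> = w" unfolding unitary_matD(2)[OF U] using w by simp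
    finally have 1: "mat_adjoint U *\<^sub>v x = w" .
    have "diagonal n f *\<^sub>v w = z"
    proof (rule eq_vecI)
      fix i assume "i < dim_vec z"
      then have i: "i < n" using z by auto
      show "(diagonal n f *\<^sub>v w) $ i = z $ i"
        unfolding index_diagonal_mult_vec[OF w i] using z(2)[OF _ i] f[OF i] i by (cases "i < k") (auto simp: w_def)
    qed (use z in auto)
    then have "y = P * diagonal n f * mat_adjoint U *\<^sub>v x" using eq[OF x] 1 z by simp
    moreover have "P *\<^sub>v z \<in> carrier_vec m" using P z by (intro mult_mat_vec_carrier[of _ m n]) auto
    ultimately show "y \<in> vec_space.col_space m (P * diagonal n f * mat_adjoint U)"
      unfolding vec_space.col_space_eq[OF M] carrier_matD[OF M] using z(3) x by auto
  qed
qed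

text \<open>The rank depends only on the column space, and here that is also the column space of the
matrix consisting of the first columns of \<^term>\<open>P\<close>, which are linearly independent.\<close>

lemma rank_unitary_diagonal_unitary:
  assumes P: "unitary_mat n P" and U: "unitary_mat n U" and k: "k \<le> n"
    and f: "\<And>i. i < n \<Longrightarrow> f i \<noteq> 0 \<longleftrightarrow> i < k"
  shows "vec_space.rank n (P * diagonal n f * mat_adjoint U) = k"
proof -
  interpret vec_space "TYPE(complex)" n .
  note Pc = unitary_matD(1)[OF P]
  define B where "B = mat n k (\<lambda>(i, j). P $$ (i, j))"
  have B: "B \<in> carrier_mat n k" by (simp add: B_def)
  have colB: "col B j = col P j" if "j < k" for j
    by (rule eq_vecI) (use that k Pc in \<open>auto simp: B_def\<close>)
  have det: "det P \<noteq> 0"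
  proof
    assume "det P = 0"
    then have "det (mat_adjoint P * P) = 0" using Pc by (subst det_mult[of _ n]) auto
    then show False unfolding unitary_matD(2)[OF P] by simp
  qed
  have li: "lin_indpt (set (cols P))" using lin_dep_cols_imp_det_0[OF Pc] det by auto
  have inj: "i = j" if "i < n" "j < n" "col P i = col P j" for i j
  proof (rule ccontr)
    assume "i \<noteq> j"
    have "(\<Sum>a<n. P $$ (a, i) * cnj (P $$ (a, j))) = (\<Sum>a<n. P $$ (a, j) * cnj (P $$ (a, j)))"
    proof (intro sum.cong refl)
      fix a assume "a \<in> {..<n}"
      then have "P $$ (a, i) = P $$ (a, j)" using that Pc by (metis carrier_matD index_col lessThan_iff)
      then show "P $$ (a, i) * cnj (P $$ (a, j)) = P $$ (a, j) * cnj (P $$ (a, j))" by simp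
    qed
    then show False using unitary_mat_columns[OF P] that \<open>i \<noteq> j\<close> by simp
  qed
  have sub: "set (cols B) \<subseteq> set (cols P)"
    using B Pc k colB unfolding cols_def by fastforce
  have liB: "lin_indpt (set (cols B))" using li supset_ld_is_ld[OF _ sub] by blast
  have "distinct (cols B)"
    unfolding cols_def distinct_map using B inj colB k by (auto simp: inj_on_def)
  then have "rank B = k" using lin_indpt_full_rank[OF B _ liB] by simp
  moreover have "col_space (P * diagonal n f * mat_adjoint U) = col_space B"
  proof -
    have BP: "B *\<^sub>v x = P *\<^sub>v vec n (\<lambda>i. if i < k then x $ i else 0)" if x: "x \<in> carrier_vec k" for x
    proof (rule eq_vecI)
      fix i assume "i < dim_vec (P *\<^sub>v vec n (\<lambda>i. if i < k then x $ i else 0))"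
      then have i: "i < n" using Pc by simp
      have "(B *\<^sub>v x) $ i = (\<Sum>l<k. P $$ (i, l) * x $ l)"
        by (subst index_mult_mat_vec_sum[OF B x i]) (use i in \<open>auto simp: B_def\<close>)
      also have "\<dots> = (\<Sum>l<n. P $$ (i, l) * vec n (\<lambda>i. if i < k then x $ i else 0) $ l)"
        using k by (intro sum.mono_neutral_cong_left) auto
      also have "\<dots> = (P *\<^sub>v vec n (\<lambda>i. if i < k then x $ i else 0)) $ i"
        by (rule index_mult_mat_vec_sum[symmetric]) (use Pc i in auto)
      finally show "(B *\<^sub>v x) $ i = (P *\<^sub>v vec n (\<lambda>i. if i < k then x $ i else 0)) $ i" .
    qed (use B Pc in auto)
    have "(\<lambda>z. P *\<^sub>v z) ` coord_subspace n k = col_space B"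
    proof (intro equalityI subsetI)
      fix y assume "y \<in> (\<lambda>z. P *\<^sub>v z) ` coord_subspace n k"
      then obtain z where z: "z \<in> coord_subspace n k" and y: "y = P *\<^sub>v z" by auto
      have x: "vec k (\<lambda>i. z $ i) \<in> carrier_vec k" by simp
      have "z = vec n (\<lambda>i. if i < k then vec k (\<lambda>i. z $ i) $ i else 0)"
        by (rule eq_vecI) (use z in \<open>auto simp: coord_subspace_def\<close>)
      then have "y = B *\<^sub>v vec k (\<lambda>i. z $ i)" unfolding y BP[OF x] by simp
      then show "y \<in> col_space B" unfolding col_space_eq[OF B] using B x
        by (auto intro!: mult_mat_vec_carrier[of _ n k] bexI[of _ "vec k (\<lambda>i. z $ i)"])
    next
      fix y assume "y \<in> col_space B"
      then obtain x where x: "x \<in> carrier_vec k" "y = B *\<^sub>v x" unfolding col_space_eq[OF B] using B by auto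
      then show "y \<in> (\<lambda>z. P *\<^sub>v z) ` coord_subspace n k"
        unfolding x(2) BP[OF x(1)] by (intro imageI) (auto simp: coord_subspace_def)
    qed
    then show ?thesis using col_space_mult_coord_subspace[OF Pc U f] by simp
  qed
  ultimately show ?thesis using rank_cong_col_space by metis
qed

text \<open>The zeros that the characteristic polynomial contributes are discarded, and the others are already
in decreasing order, so that the sorting in the definition has no effect.\<close>

lemma sing_vals_of_gram:
  assumes U: "unitary_mat n U" and k: "k \<le> n"
    and gram: "mat_adjoint A * A = U * diagonal n (\<lambda>i. of_real ((f i)\<^sup>2)) * mat_adjoint U"
    and pos: "\<And>i. i < k \<Longrightarrow> 0 < f i" and zero: "\<And>i. k \<le> i \<Longrightarrow> i < n \<Longrightarrow> f i = 0"
    and dec: "\<And>i j. i \<le> j \<Longrightarrow> j < n \<Longrightarrow> f j \<le> f i"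
  shows "sing_vals A = map f [0..<k]"
proof -
  have up: "upper_triangular (diagonal n (\<lambda>i. of_real ((f i)\<^sup>2)))"
    by (auto simp: upper_triangular_def)
  have "char_poly (mat_adjoint A * A) = char_poly (diagonal n (\<lambda>i. of_real ((f i)\<^sup>2)))"
    unfolding gram by (rule char_poly_unitary_conjugate[OF diagonal_carrier U])
  also have "\<dots> = (\<Prod>a\<leftarrow>diag_mat (diagonal n (\<lambda>i. of_real ((f i)\<^sup>2))). [:- a, 1:])"
    by (rule char_poly_upper_triangular[OF diagonal_carrier up])
  also have "diag_mat (diagonal n (\<lambda>i. of_real ((f i)\<^sup>2))) = map (\<lambda>i. of_real ((f i)\<^sup>2)) [0..<n]"
    by (auto simp: diag_mat_def)
  finally have cp: "char_poly (mat_adjoint A * A) = (\<Prod>a\<leftarrow>map (\<lambda>i. of_real ((f i)\<^sup>2)) [0..<n]. [:- a, 1:])" .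
  have roots: "proots (\<Prod>a\<leftarrow>as. [:- a, 1:]) = mset as" for as :: "complex list"
  proof (induction as)
    case (Cons a as)
    have "(\<Prod>a\<leftarrow>as. [:- a, 1:]) \<noteq> 0" by (auto simp: prod_list_zero_iff)
    then show ?case using Cons by (simp add: proots_mult del: mult_pCons_left)
  qed simp
  have split: "[0..<n] = [0..<k] @ [k..<n]" using k by (metis le_add_diff_inverse upt_add_eq_append zero_le)
  have "filter_mset (\<lambda>z. z \<noteq> 0) (proots (char_poly (mat_adjoint A * A)))
      = mset (filter (\<lambda>z. z \<noteq> 0) (map (\<lambda>i. of_real ((f i)\<^sup>2)) [0..<n]))"
    unfolding cp roots by (simp only: mset_filter)
  also have "filter (\<lambda>z. z \<noteq> 0) (map (\<lambda>i. of_real ((f i)\<^sup>2) :: complex) [0..<n]) = map (\<lambda>i. of_real ((f i)\<^sup>2)) [0..<k]"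
    unfolding split using pos zero by (auto simp: filter_empty_conv intro!: filter_True)
      fastforce+
  finally have "image_mset (\<lambda>z. sqrt (Re z)) (filter_mset (\<lambda>z. z \<noteq> 0) (proots (char_poly (mat_adjoint A * A))))
      = mset (map (\<lambda>z. sqrt (Re z)) (map (\<lambda>i. of_real ((f i)\<^sup>2)) [0..<k]))"
    by (simp only: mset_map)
  also have "map (\<lambda>z. sqrt (Re z)) (map (\<lambda>i. of_real ((f i)\<^sup>2)) [0..<k]) = map f [0..<k]"
    using pos by (auto intro!: real_sqrt_unique simp: less_imp_le)
  finally have 1: "sing_vals A = rev (sort (map f [0..<k]))"
    unfolding sing_vals_def by (simp only: sorted_list_of_multiset_mset)
  have "sorted (rev (map f [0..<k]))"
    using dec k by (auto simp: sorted_iff_nth_mono rev_nth)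
  then have "sort (map f [0..<k]) = rev (map f [0..<k])"
    by (intro properties_for_sort) auto
  then show ?thesis unfolding 1 by simp
qed

section \<open>Singular value expansions of a matrix and of its positive polar factor\<close>

definition orthonormal_family :: "nat \<Rightarrow> nat \<Rightarrow> (nat \<Rightarrow> nat \<Rightarrow> complex) \<Rightarrow> bool" where
  "orthonormal_family m r p \<longleftrightarrow>
     (\<forall>i<r. \<forall>j<r. (\<Sum>a<m. p i a * cnj (p j a)) = (if i = j then 1 else 0))"

text \<open>A singular value decomposition with the matrices replaced by families of vectors, given by their
coordinates. Inner products of two such expansions are finite double sums.\<close>

definition singular_expansion ::
    "nat \<Rightarrow> nat \<Rightarrow> nat \<Rightarrow> (nat \<Rightarrow> real) \<Rightarrow> (nat \<Rightarrow> nat \<Rightarrow> complex) \<Rightarrow> (nat \<Rightarrow> nat \<Rightarrow> complex) \<Rightarrow> complex mat \<Rightarrow> bool" where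
  "singular_expansion m n r \<sigma> p u A \<longleftrightarrow>
     A \<in> carrier_mat m n \<and> orthonormal_family m r p \<and> orthonormal_family n r u \<and>
     (\<forall>a<m. \<forall>b<n. A $$ (a, b) = (\<Sum>i<r. of_real (\<sigma> i) * p i a * cnj (u i b)))"

lemma sum_two_points:
  fixes f :: "nat \<Rightarrow> 'a :: comm_monoid_add"
  assumes "i < r" "j < r" "i \<noteq> j" "\<And>k. k < r \<Longrightarrow> k \<noteq> i \<Longrightarrow> k \<noteq> j \<Longrightarrow> f k = 0"
  shows "(\<Sum>k<r. f k) = f i + f j"
proof -
  have "(\<Sum>k<r. f k) = (\<Sum>k\<in>{i, j}. f k)"
    by (rule sum.mono_neutral_right) (use assms in auto)
  then show ?thesis using assms by simp
qed

text \<open>Polarization: the quadratic form determines the sesquilinear form. Testing with one unit vector,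
with the sum of two, and with the sum of one and \<^term>\<open>\<i>\<close> times another suffices.\<close>

lemma gram_eq_identity_of_isometric:
  fixes g :: "nat \<Rightarrow> nat \<Rightarrow> complex"
  assumes iso: "\<And>c. (\<Sum>i<r. \<Sum>j<r. c i * cnj (c j) * g i j) = (\<Sum>i<r. c i * cnj (c i))"
    and ij: "i < r" "j < r"
  shows "g i j = (if i = j then 1 else 0)"
proof -
  have diag: "g k k = 1" if "k < r" for k
  proof -
    have "(\<Sum>i<r. \<Sum>j<r. (if i = k then 1 else 0) * cnj (if j = k then 1 else 0) * g i j)
        = (\<Sum>i<r. if i = k then g i k else 0)"
    proof (intro sum.cong refl)
      fix i assume "i \<in> {..<r}"
      have "(\<Sum>j<r. (if i = k then 1 else 0) * cnj (if j = k then 1 else 0) * g i j)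
          = (\<Sum>j<r. if j = k then (if i = k then g i j else 0) else 0)"
        by (intro sum.cong) auto
      then show "(\<Sum>j<r. (if i = k then 1 else 0) * cnj (if j = k then 1 else 0) * g i j)
          = (if i = k then g i k else 0)" using that by simp
    qed
    moreover have "(\<Sum>i<r. (if i = k then 1 else 0) * cnj (if i = k then 1 else 0))
        = (\<Sum>i<r. if i = k then (1 :: complex) else 0)"
      by (intro sum.cong) auto
    ultimately show ?thesis using iso[of "\<lambda>i. if i = k then 1 else 0"] that by simp
  qed
  show ?thesis
  proof (cases "i = j")
    case True
    then show ?thesis using diag ij by simp
  next
    case False
    \<comment> \<open>Test vector with entry one at position i and entry t at position j.\<close>
    have pair: "t * cnj t + (g i i + cnj t * g i j + (t * g j i + t * cnj t * g j j)) =
        t * cnj t + (1 + t * cnj t)" for t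
    proof -
      define c where "c k = (if k = i then 1 else if k = j then t else 0)" for k
      have "(\<Sum>i'<r. \<Sum>j'<r. c i' * cnj (c j') * g i' j')
          = (\<Sum>j'<r. c i * cnj (c j') * g i j') + (\<Sum>j'<r. c j * cnj (c j') * g j j')"
        using ij False by (intro sum_two_points) (auto simp: c_def)
      also have "(\<Sum>j'<r. c i * cnj (c j') * g i j') = g i i + cnj t * g i j"
        using ij False by (subst sum_two_points[of i r j]) (auto simp: c_def)
      also have "(\<Sum>j'<r. c j * cnj (c j') * g j j') = t * g j i + t * cnj t * g j j"
        using ij False by (subst sum_two_points[of i r j]) (auto simp: c_def)
      also have "(\<Sum>i'<r. \<Sum>j'<r. c i' * cnj (c j') * g i' j') = (\<Sum>i'<r. c i' * cnj (c i'))"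
        by (rule iso)
      also have "\<dots> = 1 + t * cnj t"
        using ij False by (subst sum_two_points[of i r j]) (auto simp: c_def)
      finally show ?thesis by simp
    qed
    have "g i j + g j i = 0" using pair[of 1] diag ij by simp
    moreover have "\<i> * (g j i - g i j) = 0" using pair[of \<i>] diag ij by (simp add: algebra_simps)
    ultimately have "g i j = 0" by simp
    then show ?thesis using False by simp
  qed
qed

lemma sum_square_expand:
  fixes W :: "nat \<Rightarrow> nat \<Rightarrow> complex"
  shows "(\<Sum>a<m. (\<Sum>i<r. c i * W a i) * cnj (\<Sum>i<r. c i * W a i))
      = (\<Sum>i<r. \<Sum>j<r. c i * cnj (c j) * (\<Sum>a<m. W a i * cnj (W a j)))"
proof -
  have "(\<Sum>a<m. (\<Sum>i<r. c i * W a i) * cnj (\<Sum>i<r. c i * W a i))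
      = (\<Sum>a<m. \<Sum>i<r. \<Sum>j<r. c i * cnj (c j) * (W a i * cnj (W a j)))"
    by (simp add: sum_product mult_ac)
  also have "\<dots> = (\<Sum>i<r. \<Sum>a<m. \<Sum>j<r. c i * cnj (c j) * (W a i * cnj (W a j)))"
    by (rule sum.swap)
  also have "\<dots> = (\<Sum>i<r. \<Sum>j<r. \<Sum>a<m. c i * cnj (c j) * (W a i * cnj (W a j)))"
    by (intro sum.cong refl sum.swap)
  finally show ?thesis by (simp add: sum_distrib_left)
qed

text \<open>A first diagonalization, in an arbitrary order, shows that the eigenvalues are real and nonnegative.
They can then be sorted, and the second diagonalization uses them in decreasing order.\<close>

lemma pos_semidef_diagonalization:
  assumes H: "H \<in> carrier_mat n n" and psd: "pos_semidef H"
  shows "\<exists>U d. unitary_mat n U \<and> H = U * diagonal n (\<lambda>i. of_real (d i)) * mat_adjoint U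
    \<and> (\<forall>i<n. 0 \<le> d i) \<and> (\<forall>i j. i \<le> j \<longrightarrow> j < n \<longrightarrow> d j \<le> d i)"
proof -
  have herm: "mat_adjoint H = H" and pos: "\<And>x. x \<in> carrier_vec n \<Longrightarrow> 0 \<le> Re ((H *\<^sub>v x) \<bullet>c x)"
    using psd H unfolding pos_semidef_def by auto
  obtain es where es: "char_poly H = (\<Prod>e\<leftarrow>es. [:- e, 1:])" "length es = n"
    using char_poly_factorized[OF H] by blast
  obtain U where U: "unitary_mat n U" and HU: "H = U * diagonal n (\<lambda>i. es ! i) * mat_adjoint U"
    using spectral_theorem[OF H herm es(1)] by blast
  note Uc = unitary_matD(1)[OF U]
  have D: "mat_adjoint U * H * U = diagonal n (\<lambda>i. es ! i)"
    using unitary_conjugate_cancel[OF diagonal_carrier unitary_mat_adjoint[OF U], of "\<lambda>i. es ! i"]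
    unfolding HU by simp
  have real_nonneg: "es ! i = of_real (Re (es ! i)) \<and> 0 \<le> Re (es ! i)" if i: "i < n" for i
  proof
    have "mat_adjoint (diagonal n (\<lambda>i. es ! i)) = diagonal n (\<lambda>i. es ! i)"
      using hermitian_conjugate[OF H herm Uc] unfolding D .
    then have "cnj (es ! i) = es ! i"
      using index_mat_adjoint[of i "diagonal n (\<lambda>i. es ! i)" i] i by simp
    then show "es ! i = of_real (Re (es ! i))" by (simp add: complex_eq_iff)
    have "es ! i = (mat_adjoint U * (H * U)) $$ (i, i)"
      using D i H Uc by (simp add: assoc_mult_mat[of _ n n _ n _ n])
    also have "\<dots> = (\<Sum>a<n. mat_adjoint U $$ (i, a) * (H * U) $$ (a, i))"
      by (rule index_mult_mat_sum) (use H Uc i in auto)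
    also have "\<dots> = (\<Sum>a<n. (H *\<^sub>v col U i) $ a * cnj (col U i $ a))"
      using H Uc i by (intro sum.cong) auto
    also have "\<dots> = (H *\<^sub>v col U i) \<bullet>c col U i"
      using H Uc i by (auto simp: scalar_prod_def lessThan_atLeast0 intro!: sum.cong)
    finally show "0 \<le> Re (es ! i)" using pos[of "col U i"] Uc i by simp
  qed
  define ds where "ds = rev (sort (map Re es))"
  have len: "length ds = n" using es by (simp add: ds_def)
  have "mset (map of_real ds) = image_mset (\<lambda>z. of_real (Re z)) (mset es)"
    by (simp add: ds_def image_mset.compositionality o_def)
  also have "\<dots> = image_mset (\<lambda>z. z) (mset es)"
    using real_nonneg es(2) by (intro image_mset_cong) (auto simp: in_set_conv_nth)
  finally have ms: "mset (map of_real ds) = mset es" by simp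
  have "prod_mset (image_mset (\<lambda>e. [:- e, 1:]) (mset es))
      = prod_mset (image_mset (\<lambda>e. [:- e, 1:]) (mset (map of_real ds)))"
    by (simp only: ms)
  then have "(\<Prod>e\<leftarrow>es. [:- e, 1:]) = (\<Prod>e\<leftarrow>map of_real ds. [:- e, 1:])"
    by (simp only: mset_map[symmetric] prod_mset_prod_list)
  then obtain V where V: "unitary_mat n V"
    and HV: "H = V * diagonal n (\<lambda>i. map of_real ds ! i) * mat_adjoint V"
    using spectral_theorem[OF H herm, of "map of_real ds"] es(1) by auto
  have "diagonal n (\<lambda>i. map of_real ds ! i) = diagonal n (\<lambda>i. of_real (ds ! i))"
    by (rule diagonal_cong) (use len in auto)
  moreover have "0 \<le> ds ! i" if "i < n" for i
  proof -
    have "ds ! i \<in> set ds" using that len by simp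
    then show ?thesis using real_nonneg es(2) unfolding ds_def by (auto simp: in_set_conv_nth)
  qed
  moreover have "ds ! j \<le> ds ! i" if "i \<le> j" "j < n" for i j
  proof -
    have "sorted (rev ds)" by (simp add: ds_def)
    then show ?thesis using that len by (simp add: sorted_rev_nth_mono)
  qed
  ultimately show ?thesis using V HV by (intro exI[of _ V] exI[of _ "\<lambda>i. ds ! i"]) auto
qed

text \<open>The two factors share their right singular vectors: if the columns \<open>u\<close> diagonalize
\<^term>\<open>H\<close>, then those for nonzero eigenvalues span the range of \<^term>\<open>H\<close>. By the uniqueness
condition this is the range of the adjoint of \<^term>\<open>Q\<close>, where \<^term>\<open>Q\<close> is isometric.
Hence their images \<open>p\<close> under \<^term>\<open>Q\<close> are orthonormal as well.\<close>

lemma gen_polar_decomp_expansion: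
  assumes gpd: "gen_polar_decomp r m n A Q H"
  shows "\<exists>\<sigma> p u. sing_vals A = map \<sigma> [0..<r] \<and> (\<forall>i<r. 0 < \<sigma> i) \<and> (\<forall>i j. i \<le> j \<longrightarrow> j < r \<longrightarrow> \<sigma> j \<le> \<sigma> i)
    \<and> singular_expansion m n r \<sigma> p u A \<and> singular_expansion n n r \<sigma> u u H"
proof -
  from gpd have Q: "Q \<in> carrier_mat m n" and sub: "subunitary Q" and H: "H \<in> carrier_mat n n"
    and rkH: "vec_space.rank n H = r" and psd: "pos_semidef H" and A: "A = Q * H"
    and cs: "vec_space.col_space n (mat_adjoint Q) = vec_space.col_space n H"
    unfolding gen_polar_decomp_def rank_carrier_mat_def by auto
  obtain U d where U: "unitary_mat n U" and HU: "H = U * diagonal n (\<lambda>i. of_real (d i)) * mat_adjoint U"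
    and d: "\<forall>i<n. 0 \<le> d i" "\<forall>i j. i \<le> j \<longrightarrow> j < n \<longrightarrow> d j \<le> d i"
    using pos_semidef_diagonalization[OF H psd] by (elim exE conjE)
  have d0: "0 \<le> d i" if "i < n" for i using d(1) that by simp
  have dec: "d j \<le> d i" if "i \<le> j" "j < n" for i j using d(2) that by simp
  note Uc = unitary_matD(1)[OF U]
  \<comment> \<open>The number of nonzero eigenvalues; the rank of H identifies it with r.\<close>
  define k where "k = (LEAST i. i = n \<or> d i = 0)"
  have kn: "k \<le> n" unfolding k_def by (rule Least_le) simp
  have k_prop: "k = n \<or> d k = 0" unfolding k_def by (rule LeastI[of _ n]) simp
  have pos: "0 < d i" if "i < k" for i
    using not_less_Least[of i "\<lambda>i. i = n \<or> d i = 0"] that d0[of i] kn unfolding k_def[symmetric] by auto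
  have zero: "d i = 0" if "k \<le> i" "i < n" for i
    using k_prop dec[of k i] d0[of i] that by auto
  have supp: "(of_real (d i) :: complex) \<noteq> 0 \<longleftrightarrow> i < k" if "i < n" for i
    using pos[of i] zero[of i] that by (cases "i < k") auto
  have kr: "k = r"
    using rank_unitary_diagonal_unitary[OF U U kn supp] rkH unfolding HU by blast
  note pos = pos[unfolded kr] and zero = zero[unfolded kr] and kn = kn[unfolded kr] and supp = supp[unfolded kr]
  define W where "W = Q * U"
  have W: "W \<in> carrier_mat m n" unfolding W_def using Q Uc by (rule mult_carrier_mat)
  have iso: "(\<Sum>a<m. (\<Sum>i<r. c i * W $$ (a, i)) * cnj (\<Sum>i<r. c i * W $$ (a, i))) = (\<Sum>i<r. c i * cnj (c i))" for c
  proof -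
    define z where "z = vec n (\<lambda>i. if i < r then c i else 0)"
    have z: "z \<in> coord_subspace n r" by (auto simp: z_def coord_subspace_def)
    have zc: "z \<in> carrier_vec n" by (simp add: z_def)
    have mv: "(M *\<^sub>v z) $ a = (\<Sum>i<r. c i * M $$ (a, i))" if M: "M \<in> carrier_mat k n" and a: "a < k" for M k a
    proof -
      have "(M *\<^sub>v z) $ a = (\<Sum>i<n. M $$ (a, i) * z $ i)" by (rule index_mult_mat_vec_sum[OF M zc a])
      also have "\<dots> = (\<Sum>i<r. c i * M $$ (a, i))"
        using kn by (intro sum.mono_neutral_cong_right) (auto simp: z_def)
      finally show ?thesis .
    qed
    have sq: "(M *\<^sub>v z) \<bullet>c (M *\<^sub>v z) = (\<Sum>a<k. (\<Sum>i<r. c i * M $$ (a, i)) * cnj (\<Sum>i<r. c i * M $$ (a, i)))"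
      if M: "M \<in> carrier_mat k n" for M k
    proof -
      have "(M *\<^sub>v z) \<bullet>c (M *\<^sub>v z) = (\<Sum>a<k. (M *\<^sub>v z) $ a * cnj ((M *\<^sub>v z) $ a))"
        using M by (auto simp: scalar_prod_def lessThan_atLeast0 intro!: sum.cong)
      also have "\<dots> = (\<Sum>a<k. (\<Sum>i<r. c i * M $$ (a, i)) * cnj (\<Sum>i<r. c i * M $$ (a, i)))"
        by (intro sum.cong refl) (simp only: mv[OF M] lessThan_iff)
      finally show ?thesis .
    qed
    have "U *\<^sub>v z \<in> vec_space.col_space n H"
      unfolding HU using col_space_mult_coord_subspace[OF Uc U supp] z by auto
    then have "(Q *\<^sub>v (U *\<^sub>v z)) \<bullet>c (Q *\<^sub>v (U *\<^sub>v z)) = (U *\<^sub>v z) \<bullet>c (U *\<^sub>v z)"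
      using sub Q cs unfolding subunitary_def by auto
    also have "Q *\<^sub>v (U *\<^sub>v z) = W *\<^sub>v z"
      unfolding W_def by (rule assoc_mult_mat_vec[symmetric, of _ m n _ n]) (use Q Uc zc in auto)
    finally have "(\<Sum>a<m. (\<Sum>i<r. c i * W $$ (a, i)) * cnj (\<Sum>i<r. c i * W $$ (a, i)))
        = (\<Sum>a<n. (\<Sum>i<r. c i * U $$ (a, i)) * cnj (\<Sum>i<r. c i * U $$ (a, i)))"
      unfolding sq[OF W] sq[OF Uc] .
    also have "\<dots> = (\<Sum>i<r. \<Sum>j<r. c i * cnj (c j) * (\<Sum>a<n. U $$ (a, i) * cnj (U $$ (a, j))))"
      by (rule sum_square_expand)
    also have "\<dots> = (\<Sum>i<r. \<Sum>j<r. if j = i then c i * cnj (c j) else 0)"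
      using unitary_mat_columns[OF U] kn by (intro sum.cong refl) auto
    finally show ?thesis by simp
  qed
  have gramW: "(\<Sum>a<m. W $$ (a, i) * cnj (W $$ (a, j))) = (if i = j then 1 else 0)" if "i < r" "j < r" for i j
    by (rule gram_eq_identity_of_isometric[OF _ that]) (rule trans[OF sum_square_expand[where W = "\<lambda>a i. W $$ (a, i)", symmetric] iso])
  define X where "X = W * diagonal n (\<lambda>i. of_real (d i))"
  have X: "X \<in> carrier_mat m n" unfolding X_def using W by (intro mult_carrier_mat[of _ m n]) auto
  have Xe: "X $$ (a, i) = W $$ (a, i) * of_real (d i)" if "a < m" "i < n" for a i
    unfolding X_def by (rule index_mult_diagonal[OF W that])
  have AX: "A = X * mat_adjoint U"
  proof -
    have "A = Q * (U * (diagonal n (\<lambda>i. of_real (d i)) * mat_adjoint U))"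
      unfolding A HU using Uc by (simp add: assoc_mult_mat[of _ n n _ n _ n])
    also have "\<dots> = W * (diagonal n (\<lambda>i. of_real (d i)) * mat_adjoint U)"
      unfolding W_def by (rule assoc_mult_mat[symmetric, of _ m n _ n _ n]) (use Q Uc in auto)
    also have "\<dots> = X * mat_adjoint U"
      unfolding X_def by (rule assoc_mult_mat[symmetric, of _ m n _ n _ n]) (use W Uc in auto)
    finally show ?thesis .
  qed
  have Ac: "A \<in> carrier_mat m n" unfolding A using Q H by (rule mult_carrier_mat)
  have XX: "mat_adjoint X * X = diagonal n (\<lambda>i. of_real ((d i)\<^sup>2))"
  proof (rule eq_matI)
    fix i j assume "i < dim_row (diagonal n (\<lambda>i. of_real ((d i)\<^sup>2)))" "j < dim_col (diagonal n (\<lambda>i. of_real ((d i)\<^sup>2)))"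
    then have ij: "i < n" "j < n" by auto
    have "(mat_adjoint X * X) $$ (i, j) = (\<Sum>a<m. mat_adjoint X $$ (i, a) * X $$ (a, j))"
      by (rule index_mult_mat_sum) (use X ij in auto)
    also have "\<dots> = (\<Sum>a<m. (of_real (d i) * of_real (d j)) * (W $$ (a, j) * cnj (W $$ (a, i))))"
      using X ij by (intro sum.cong refl) (auto simp: Xe)
    also have "\<dots> = (of_real (d i) * of_real (d j)) * (\<Sum>a<m. W $$ (a, j) * cnj (W $$ (a, i)))"
      by (simp add: sum_distrib_left)
    also have "\<dots> = diagonal n (\<lambda>i. of_real ((d i)\<^sup>2)) $$ (i, j)"
      using gramW[of j i] zero[of i] zero[of j] ij
      by (cases "i < r"; cases "j < r") (auto simp: power2_eq_square)
    finally show "(mat_adjoint X * X) $$ (i, j) = diagonal n (\<lambda>i. of_real ((d i)\<^sup>2)) $$ (i, j)" .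
  qed (use X in auto)
  have "mat_adjoint A * A = (U * mat_adjoint X) * (X * mat_adjoint U)"
    unfolding AX by (subst mat_adjoint_mult[of _ m n _ n]) (use X Uc in auto)
  also have "\<dots> = U * (mat_adjoint X * (X * mat_adjoint U))"
    by (rule assoc_mult_mat[of _ n n _ m _ n]) (use X Uc in \<open>auto intro!: mult_carrier_mat[of _ m n]\<close>)
  also have "mat_adjoint X * (X * mat_adjoint U) = (mat_adjoint X * X) * mat_adjoint U"
    by (rule assoc_mult_mat[symmetric, of _ n m _ n _ n]) (use X Uc in auto)
  also have "U * ((mat_adjoint X * X) * mat_adjoint U) = U * (mat_adjoint X * X) * mat_adjoint U"
    by (rule assoc_mult_mat[symmetric, of _ n n _ n _ n])
      (use X Uc in \<open>auto intro!: mult_carrier_mat[of _ n m]\<close>)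
  finally have gram: "mat_adjoint A * A = U * diagonal n (\<lambda>i. of_real ((d i)\<^sup>2)) * mat_adjoint U"
    unfolding XX .
  have sv: "sing_vals A = map d [0..<r]"
    by (rule sing_vals_of_gram[OF U kn gram]) (fact pos zero dec)+
  define p where "p i a = W $$ (a, i)" for i a
  define u where "u i a = U $$ (a, i)" for i a
  have entry: "(Y * mat_adjoint U) $$ (a, b) = (\<Sum>i<r. of_real (d i) * V $$ (a, i) * cnj (U $$ (b, i)))"
    if Y: "Y \<in> carrier_mat l n" "\<And>a i. a < l \<Longrightarrow> i < n \<Longrightarrow> Y $$ (a, i) = V $$ (a, i) * of_real (d i)"
      and ab: "a < l" "b < n" for Y V l a b
  proof -
    have "(Y * mat_adjoint U) $$ (a, b) = (\<Sum>i<n. Y $$ (a, i) * mat_adjoint U $$ (i, b))"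
      by (rule index_mult_mat_sum) (use Y Uc ab in auto)
    also have "\<dots> = (\<Sum>i<n. of_real (d i) * V $$ (a, i) * cnj (U $$ (b, i)))"
      using Uc ab by (intro sum.cong) (auto simp: Y(2))
    also have "\<dots> = (\<Sum>i<r. of_real (d i) * V $$ (a, i) * cnj (U $$ (b, i)))"
      using kn zero by (intro sum.mono_neutral_right) auto
    finally show ?thesis .
  qed
  have op: "orthonormal_family m r p" unfolding orthonormal_family_def p_def using gramW by simp
  have ou: "orthonormal_family n r u"
    unfolding orthonormal_family_def u_def using unitary_mat_columns[OF U] kn by simp
  have "singular_expansion m n r d p u A"
    unfolding singular_expansion_def p_def u_def
    using Ac op ou entry[OF X Xe] unfolding AX p_def u_def by auto
  moreover have "singular_expansion n n r d u u H"
    unfolding singular_expansion_def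
    using H ou entry[of "U * diagonal n (\<lambda>i. of_real (d i))" n U] Uc index_mult_diagonal[OF Uc]
    unfolding HU u_def by auto
  ultimately show ?thesis using sv pos dec kn by (intro exI[of _ d] exI[of _ p] exI[of _ u]) auto
qed

section \<open>Weighted sums with substochastic weights\<close>

text \<open>Summation by parts: with decreasing nonnegative weights, a comparison of all partial sums gives
the comparison of the weighted sums. In the induction the last weight used multiplies the
accumulated excess \<open>e\<close>.\<close>

lemma abel_sum_mono:
  fixes \<sigma> x y :: "nat \<Rightarrow> real"
  assumes "\<And>i. i < r \<Longrightarrow> 0 \<le> \<sigma> i" and "\<And>i j. i \<le> j \<Longrightarrow> j < r \<Longrightarrow> \<sigma> j \<le> \<sigma> i"
    and "\<And>k. k \<le> r \<Longrightarrow> (\<Sum>i<k. x i) \<le> (\<Sum>i<k. y i)"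
  shows "(\<Sum>i<r. \<sigma> i * x i) \<le> (\<Sum>i<r. \<sigma> i * y i)"
proof -
  define e where "e k = (\<Sum>i<k. y i - x i)" for k
  have e0: "0 \<le> e k" if "k \<le> r" for k
    using assms(3)[OF that] by (simp add: e_def sum_subtractf)
  have "\<sigma> (k - 1) * e k \<le> (\<Sum>i<k. \<sigma> i * (y i - x i))" if "k \<le> r" for k
    using that
  proof (induction k)
    case (Suc k)
    have "\<sigma> k * e (Suc k) = \<sigma> k * e k + \<sigma> k * (y k - x k)"
      by (simp add: e_def algebra_simps)
    also have "\<sigma> k * e k \<le> \<sigma> (k - 1) * e k"
      using Suc.prems by (intro mult_right_mono assms(2) e0) auto
    finally show ?case using Suc by simp
  qed (simp add: e_def)
  from this[OF order.refl] have "\<sigma> (r - 1) * e r \<le> (\<Sum>i<r. \<sigma> i * (y i - x i))" .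
  moreover have "0 \<le> \<sigma> (r - 1) * e r"
    using assms(1)[of "r - 1"] e0[of r] by (cases "r = 0") (auto simp: e_def)
  ultimately show ?thesis by (simp add: right_diff_distrib sum_subtractf)
qed

text \<open>The decreasing weights make it best to put all mass on the diagonal. Summation by parts in each
index reduces this to the rectangles of \<open>k\<close> rows and \<open>l\<close> columns: the entries there sum to at most
\<^term>\<open>min l k\<close>, which is the sum for the identity matrix.\<close>

lemma substochastic_weighted_sum_le:
  fixes \<sigma> \<tau> :: "nat \<Rightarrow> real" and z :: "nat \<Rightarrow> nat \<Rightarrow> real"
  assumes rs: "r \<le> s"
    and \<sigma>0: "\<And>i. i < r \<Longrightarrow> 0 \<le> \<sigma> i" and \<sigma>: "\<And>i j. i \<le> j \<Longrightarrow> j < r \<Longrightarrow> \<sigma> j \<le> \<sigma> i"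
    and \<tau>0: "\<And>i. i < s \<Longrightarrow> 0 \<le> \<tau> i" and \<tau>: "\<And>i j. i \<le> j \<Longrightarrow> j < s \<Longrightarrow> \<tau> j \<le> \<tau> i"
    and z0: "\<And>i j. 0 \<le> z i j"
    and rows: "\<And>i. i < r \<Longrightarrow> (\<Sum>j<s. z i j) \<le> 1"
    and cols: "\<And>j. j < s \<Longrightarrow> (\<Sum>i<r. z i j) \<le> 1"
  shows "(\<Sum>i<r. \<Sum>j<s. \<sigma> i * \<tau> j * z i j) \<le> (\<Sum>i<r. \<sigma> i * \<tau> i)"
proof -
  have "(\<Sum>i<r. \<sigma> i * (\<Sum>j<s. \<tau> j * z i j)) \<le> (\<Sum>i<r. \<sigma> i * \<tau> i)"
  proof (rule abel_sum_mono[OF \<sigma>0 \<sigma>])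
    fix k assume k: "k \<le> r"
    have "(\<Sum>i<k. \<Sum>j<s. \<tau> j * z i j) = (\<Sum>j<s. \<tau> j * (\<Sum>i<k. z i j))"
      by (subst sum.swap) (simp add: sum_distrib_left)
    also have "\<dots> \<le> (\<Sum>j<s. \<tau> j * (if j < k then 1 else 0))"
    proof (rule abel_sum_mono[OF \<tau>0 \<tau>])
      fix l assume l: "l \<le> s"
      have "(\<Sum>j<l. \<Sum>i<k. z i j) \<le> real l"
      proof -
        have "(\<Sum>j<l. \<Sum>i<k. z i j) \<le> (\<Sum>j<l. 1)"
        proof (rule sum_mono)
          fix j assume "j \<in> {..<l}"
          have "(\<Sum>i<k. z i j) \<le> (\<Sum>i<r. z i j)" using k z0 by (intro sum_mono2) auto
          also have "\<dots> \<le> 1" using cols[of j] l \<open>j \<in> {..<l}\<close> by simp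
          finally show "(\<Sum>i<k. z i j) \<le> 1" .
        qed
        then show ?thesis by simp
      qed
      moreover have "(\<Sum>j<l. \<Sum>i<k. z i j) \<le> real k"
      proof -
        have "(\<Sum>j<l. \<Sum>i<k. z i j) = (\<Sum>i<k. \<Sum>j<l. z i j)" by (rule sum.swap)
        also have "\<dots> \<le> (\<Sum>i<k. 1)"
        proof (rule sum_mono)
          fix i assume "i \<in> {..<k}"
          have "(\<Sum>j<l. z i j) \<le> (\<Sum>j<s. z i j)" using l z0 by (intro sum_mono2) auto
          also have "\<dots> \<le> 1" using rows[of i] k \<open>i \<in> {..<k}\<close> by simp
          finally show "(\<Sum>j<l. z i j) \<le> 1" .
        qed
        finally show ?thesis by simp
      qed
      moreover have "(\<Sum>j<l. if j < k then 1 else 0) = real (min l k)"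
      proof -
        have "(\<Sum>j<l. if j < k then 1 else (0 :: real)) = (\<Sum>j\<in>{..<l} \<inter> {j. j < k}. 1)"
          by (simp add: sum.If_cases)
        also have "{..<l} \<inter> {j. j < k} = {..<min l k}" by auto
        finally show ?thesis by simp
      qed
      ultimately show "(\<Sum>j<l. \<Sum>i<k. z i j) \<le> (\<Sum>j<l. if j < k then 1 else 0)" by simp
    qed
    also have "\<dots> = (\<Sum>j<k. \<tau> j)"
      using k rs by (intro sum.mono_neutral_cong_right) auto
    finally show "(\<Sum>i<k. \<Sum>j<s. \<tau> j * z i j) \<le> (\<Sum>i<k. \<tau> i)" .
  qed
  then show ?thesis by (simp add: sum_distrib_left mult.assoc)
qed

text \<open>The squared distance from \<^term>\<open>q\<close> to its projection onto the span of the family is nonnegative.\<close>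

lemma bessel_inequality:
  fixes q :: "nat \<Rightarrow> complex"
  assumes "orthonormal_family m r p"
  shows "(\<Sum>i<r. (cmod (\<Sum>a<m. p i a * cnj (q a)))\<^sup>2) \<le> (\<Sum>a<m. (cmod (q a))\<^sup>2)"
proof -
  define c where "c i = (\<Sum>a<m. q a * cnj (p i a))" for i
  define w where "w a = (\<Sum>i<r. c i * p i a)" for a
  have norm2: "of_real ((cmod x)\<^sup>2) = x * cnj x" for x by (rule complex_norm_square)
  have cc: "cmod (\<Sum>a<m. p i a * cnj (q a)) = cmod (c i)" for i
    by (subst complex_mod_cnj[symmetric]) (simp add: c_def mult.commute)
  have ww: "(\<Sum>a<m. w a * cnj (w a)) = (\<Sum>i<r. c i * cnj (c i))"
  proof -
    have "(\<Sum>a<m. w a * cnj (w a)) = (\<Sum>i<r. \<Sum>j<r. c i * cnj (c j) * (\<Sum>a<m. p i a * cnj (p j a)))"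
      unfolding w_def by (rule sum_square_expand)
    also have "\<dots> = (\<Sum>i<r. \<Sum>j<r. if j = i then c i * cnj (c i) else 0)"
      using assms unfolding orthonormal_family_def by (intro sum.cong refl) auto
    finally show ?thesis by simp
  qed
  have qw: "(\<Sum>a<m. q a * cnj (w a)) = (\<Sum>i<r. c i * cnj (c i))"
  proof -
    have "(\<Sum>a<m. q a * cnj (w a)) = (\<Sum>a<m. \<Sum>i<r. cnj (c i) * (q a * cnj (p i a)))"
      unfolding w_def by (simp add: sum_distrib_left mult_ac)
    also have "\<dots> = (\<Sum>i<r. \<Sum>a<m. cnj (c i) * (q a * cnj (p i a)))" by (rule sum.swap)
    also have "\<dots> = (\<Sum>i<r. cnj (c i) * c i)" by (simp only: c_def sum_distrib_left)
    finally show ?thesis by (simp add: mult.commute)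
  qed
  have wq: "(\<Sum>a<m. w a * cnj (q a)) = (\<Sum>i<r. c i * cnj (c i))"
    using arg_cong[OF qw, of cnj] by (simp add: mult.commute)
  have "complex_of_real (\<Sum>a<m. (cmod (q a - w a))\<^sup>2) = (\<Sum>a<m. (q a - w a) * cnj (q a - w a))"
    by (simp only: of_real_sum norm2)
  also have "\<dots> = (\<Sum>a<m. q a * cnj (q a)) - (\<Sum>a<m. q a * cnj (w a))
      - (\<Sum>a<m. w a * cnj (q a)) + (\<Sum>a<m. w a * cnj (w a))"
    by (simp add: algebra_simps sum.distrib sum_subtractf)
  also have "\<dots> = (\<Sum>a<m. q a * cnj (q a)) - (\<Sum>i<r. c i * cnj (c i))"
    unfolding ww qw wq by simp
  also have "\<dots> = complex_of_real ((\<Sum>a<m. (cmod (q a))\<^sup>2) - (\<Sum>i<r. (cmod (c i))\<^sup>2))"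
    by (simp only: of_real_sum of_real_diff norm2)
  finally have "(\<Sum>a<m. (cmod (q a - w a))\<^sup>2) = (\<Sum>a<m. (cmod (q a))\<^sup>2) - (\<Sum>i<r. (cmod (c i))\<^sup>2)"
    unfolding of_real_eq_iff .
  moreover have "0 \<le> (\<Sum>a<m. (cmod (q a - w a))\<^sup>2)" by (intro sum_nonneg) auto
  ultimately show ?thesis unfolding cc by simp
qed

section \<open>The Frobenius inner product\<close>

definition frob_inner :: "complex mat \<Rightarrow> complex mat \<Rightarrow> complex" where
  "frob_inner A B = (\<Sum>a<dim_row A. \<Sum>b<dim_col A. A $$ (a, b) * cnj (B $$ (a, b)))"

lemma frob_norm_squared:
  "(frob_norm A)\<^sup>2 = Re (frob_inner A A)"
proof -
  have "(frob_norm A)\<^sup>2 = (\<Sum>a<dim_row A. \<Sum>b<dim_col A. (cmod (A $$ (a, b)))\<^sup>2)"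
    unfolding frob_norm_def by (intro real_sqrt_pow2 sum_nonneg) auto
  also have "\<dots> = Re (of_real \<dots>)" by simp
  also have "\<dots> = Re (frob_inner A A)"
    unfolding frob_inner_def by (simp only: of_real_sum complex_norm_square)
  finally show ?thesis .
qed

lemma frob_norm_diff_squared:
  assumes "A \<in> carrier_mat m n" "B \<in> carrier_mat m n"
  shows "(frob_norm (A - B))\<^sup>2 = (frob_norm A)\<^sup>2 + (frob_norm B)\<^sup>2 - 2 * Re (frob_inner A B)"
proof -
  have "frob_inner (A - B) (A - B) = (\<Sum>a<m. \<Sum>b<n. A $$ (a, b) * cnj (A $$ (a, b)) + B $$ (a, b) * cnj (B $$ (a, b))
      - (A $$ (a, b) * cnj (B $$ (a, b)) + cnj (A $$ (a, b) * cnj (B $$ (a, b)))))"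
    unfolding frob_inner_def using assms by (auto intro!: sum.cong simp: algebra_simps)
  also have "\<dots> = frob_inner A A + frob_inner B B - (frob_inner A B + cnj (frob_inner A B))"
    unfolding frob_inner_def using assms by (simp add: sum.distrib sum_subtractf)
  finally show ?thesis unfolding frob_norm_squared by simp
qed

lemma frob_norm_minus_commute:
  assumes "A \<in> carrier_mat m n" "B \<in> carrier_mat m n"
  shows "frob_norm (A - B) = frob_norm (B - A)"
  unfolding frob_norm_def using assms by (auto intro!: sum.cong simp: norm_minus_commute)

lemma frob_inner_singular_expansions:
  assumes "singular_expansion m n r \<sigma> p u A" "singular_expansion m n s \<tau> q v B"
  shows "frob_inner A B = (\<Sum>i<r. \<Sum>j<s. of_real (\<sigma> i * \<tau> j) *
    ((\<Sum>a<m. p i a * cnj (q j a)) * cnj (\<Sum>b<n. u i b * cnj (v j b))))"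
proof -
  have A: "A \<in> carrier_mat m n" using assms(1) by (simp add: singular_expansion_def)
  have "frob_inner A B = (\<Sum>a<m. \<Sum>b<n. \<Sum>i<r. \<Sum>j<s. of_real (\<sigma> i * \<tau> j) *
      ((p i a * cnj (q j a)) * cnj (u i b * cnj (v j b))))"
    unfolding frob_inner_def carrier_matD[OF A]
  proof (intro sum.cong refl, goal_cases)
    case (1 a b)
    then have "A $$ (a, b) = (\<Sum>i<r. of_real (\<sigma> i) * p i a * cnj (u i b))"
      "B $$ (a, b) = (\<Sum>j<s. of_real (\<tau> j) * q j a * cnj (v j b))"
      using assms A unfolding singular_expansion_def by auto
    then show ?case by (simp add: sum_product mult_ac)
  qed
  also have "\<dots> = (\<Sum>a<m. \<Sum>i<r. \<Sum>b<n. \<Sum>j<s. of_real (\<sigma> i * \<tau> j) *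
      ((p i a * cnj (q j a)) * cnj (u i b * cnj (v j b))))"
    by (intro sum.cong refl sum.swap)
  also have "\<dots> = (\<Sum>a<m. \<Sum>i<r. \<Sum>j<s. \<Sum>b<n. of_real (\<sigma> i * \<tau> j) *
      ((p i a * cnj (q j a)) * cnj (u i b * cnj (v j b))))"
    by (intro sum.cong refl sum.swap)
  also have "\<dots> = (\<Sum>i<r. \<Sum>a<m. \<Sum>j<s. \<Sum>b<n. of_real (\<sigma> i * \<tau> j) *
      ((p i a * cnj (q j a)) * cnj (u i b * cnj (v j b))))"
    by (rule sum.swap)
  also have "\<dots> = (\<Sum>i<r. \<Sum>j<s. \<Sum>a<m. \<Sum>b<n. of_real (\<sigma> i * \<tau> j) *
      ((p i a * cnj (q j a)) * cnj (u i b * cnj (v j b))))"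
    by (intro sum.cong refl sum.swap)
  also have "\<dots> = (\<Sum>i<r. \<Sum>j<s. of_real (\<sigma> i * \<tau> j) *
    ((\<Sum>a<m. p i a * cnj (q j a)) * cnj (\<Sum>b<n. u i b * cnj (v j b))))"
    unfolding cnj_sum sum_product unfolding sum_distrib_left ..
  finally show ?thesis .
qed

lemma frob_norm_singular_expansion:
  assumes "singular_expansion m n r \<sigma> p u A"
  shows "(frob_norm A)\<^sup>2 = (\<Sum>i<r. (\<sigma> i)\<^sup>2)"
proof -
  have "frob_inner A A = (\<Sum>i<r. \<Sum>j<r. of_real (\<sigma> i * \<sigma> j) *
    ((\<Sum>a<m. p i a * cnj (p j a)) * cnj (\<Sum>b<n. u i b * cnj (u j b))))"
    by (rule frob_inner_singular_expansions[OF assms assms])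
  also have "\<dots> = (\<Sum>i<r. \<Sum>j<r. if j = i then of_real ((\<sigma> i)\<^sup>2) else 0)"
    using assms unfolding singular_expansion_def orthonormal_family_def
    by (intro sum.cong refl) (auto simp: power2_eq_square)
  also have "\<dots> = of_real (\<Sum>i<r. (\<sigma> i)\<^sup>2)" by simp
  finally show ?thesis unfolding frob_norm_squared by simp
qed

section \<open>The trade-off between the two inner products\<close>

text \<open>The square of the coefficient is the smaller root of a quadratic polynomial, and the upper bound
comes from this equation. In the extremal configuration half of the root is a cosine; the root can
be 2, in which case the two matrices of that configuration coincide.\<close>

lemma polar_coeff_root:
  fixes F G :: real
  assumes G: "0 < G" and FG: "2 * G \<le> F"
  defines "c \<equiv> (F - sqrt (F\<^sup>2 - 2 * G * F)) / G"
  shows "G * c\<^sup>2 - 2 * F * c + 2 * F = 0" "0 < c" "c \<le> 2" "c = 2 \<Longrightarrow> F = 2 * G"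
proof -
  define S where "S = sqrt (F\<^sup>2 - 2 * G * F)"
  have FF: "F\<^sup>2 - 2 * G * F = F * (F - 2 * G)" by (simp add: power2_eq_square algebra_simps)
  have S2: "S\<^sup>2 = F\<^sup>2 - 2 * G * F" unfolding S_def FF using assms by (intro real_sqrt_pow2) auto
  have S0: "0 \<le> S" unfolding S_def FF using assms by (intro real_sqrt_ge_zero) auto
  have Gc: "G * c = F - S" using G by (simp add: c_def S_def)
  have "G * (G * c\<^sup>2 - 2 * F * c + 2 * F) = (G * c)\<^sup>2 - 2 * F * (G * c) + 2 * G * F"
    by (simp add: power2_eq_square algebra_simps)
  also have "\<dots> = 0" unfolding Gc using S2 by (simp add: power2_eq_square algebra_simps)
  finally show "G * c\<^sup>2 - 2 * F * c + 2 * F = 0" using G by simp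
  have "S\<^sup>2 < F\<^sup>2" unfolding S2 using G FG by simp
  then have "S < F" using G FG by (intro power_less_imp_less_base[of S 2 F]) auto
  then have "0 < G * c" unfolding Gc by simp
  then show "0 < c" using G by (simp add: zero_less_mult_iff)
  have "(F - 2 * G)\<^sup>2 \<le> S\<^sup>2" unfolding S2 FF using G FG by (simp add: power2_eq_square mult_right_mono)
  then have le: "F - 2 * G \<le> S" using S0 by (rule power2_le_imp_le)
  then have "G * c \<le> G * 2" unfolding Gc by simp
  then show "c \<le> 2" using G by simp
  assume "c = 2"
  then have "S = F - 2 * G" using Gc by simp
  then have sq: "(F - 2 * G) * (F - 2 * G) = F * (F - 2 * G)" using S2 unfolding FF unfolding power2_eq_square by simp
  have "2 * G * (F - 2 * G) = F * (F - 2 * G) - (F - 2 * G) * (F - 2 * G)"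
    by (simp add: algebra_simps)
  then have "2 * G * (F - 2 * G) = 0" unfolding sq by simp
  then have "2 * G = 0 \<or> F - 2 * G = 0" by (simp only: mult_eq_0_iff)
  then have "F - 2 * G = 0" using G by linarith
  then show "F = 2 * G" by simp
qed

text \<open>The weights are tuned to the case where the modulus of \<^term>\<open>y\<close> is \<^term>\<open>c / 2\<close> times that of
\<^term>\<open>x\<close>, the ratio that occurs in the extremal configuration.\<close>

lemma weighted_am_gm_complex:
  fixes x y :: complex and c :: real
  assumes "0 \<le> c"
  shows "2 * c * Re (x * cnj y) \<le> 2 * (cmod y)\<^sup>2 + c\<^sup>2 / 2 * (cmod x)\<^sup>2"
proof -
  have "Re (x * cnj y) \<le> cmod (x * cnj y)" by (rule complex_Re_le_cmod)
  then have "2 * c * Re (x * cnj y) \<le> 2 * c * (cmod x * cmod y)"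
    using assms by (simp add: norm_mult mult_left_mono)
  also have "\<dots> \<le> 2 * (cmod y)\<^sup>2 + c\<^sup>2 / 2 * (cmod x)\<^sup>2"
    using zero_le_power2[of "2 * cmod y - c * cmod x"] by (simp add: power2_eq_square algebra_simps)
  finally show ?thesis .
qed

text \<open>Both inner products are sums over pairs of singular values. With \<open>\<alpha>\<close> and \<open>\<beta>\<close> the overlaps of the
left and of the right singular vectors, the first one contains \<open>\<alpha> \<beta>\<^sup>*\<close> and the second one the
squared modulus of \<open>\<beta>\<close>. The inequality between the means, applied to each pair,
leaves the squared moduli of \<open>\<alpha>\<close>. These are substochastic by Bessel's inequality in both
directions.\<close>

lemma inner_products_trade_off:
  fixes c :: real
  assumes rs: "r \<le> s" and c: "0 \<le> c"
    and A: "singular_expansion m n r \<sigma> p u A" and H: "singular_expansion n n r \<sigma> u u H"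
    and B: "singular_expansion m n s \<tau> q v B" and K: "singular_expansion n n s \<tau> v v K"
    and \<sigma>0: "\<And>i. i < r \<Longrightarrow> 0 \<le> \<sigma> i" and \<sigma>: "\<And>i j. i \<le> j \<Longrightarrow> j < r \<Longrightarrow> \<sigma> j \<le> \<sigma> i"
    and \<tau>0: "\<And>i. i < s \<Longrightarrow> 0 \<le> \<tau> i" and \<tau>: "\<And>i j. i \<le> j \<Longrightarrow> j < s \<Longrightarrow> \<tau> j \<le> \<tau> i"
  shows "2 * c * Re (frob_inner A B) \<le> 2 * Re (frob_inner H K) + c\<^sup>2 / 2 * (\<Sum>i<r. \<sigma> i * \<tau> i)"
proof -
  define \<alpha> where "\<alpha> i j = (\<Sum>a<m. p i a * cnj (q j a))" for i j
  define \<beta> where "\<beta> i j = (\<Sum>b<n. u i b * cnj (v j b))" for i j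
  have p: "orthonormal_family m r p" and q: "orthonormal_family m s q"
    using A B by (auto simp: singular_expansion_def)
  have unit: "(\<Sum>a<m. (cmod (x j a))\<^sup>2) = 1" if "orthonormal_family m k x" "j < k" for x j k
  proof -
    have "complex_of_real (\<Sum>a<m. (cmod (x j a))\<^sup>2) = 1"
      using that unfolding orthonormal_family_def by (simp only: of_real_sum complex_norm_square) auto
    then show ?thesis by (simp only: of_real_eq_1_iff)
  qed
  have cols: "(\<Sum>i<r. (cmod (\<alpha> i j))\<^sup>2) \<le> 1" if "j < s" for j
    using bessel_inequality[OF p, of "q j"] unit[OF q that] unfolding \<alpha>_def by simp
  have \<alpha>_swap: "cmod (\<alpha> i j) = cmod (\<Sum>a<m. q j a * cnj (p i a))" for i j
    unfolding \<alpha>_def by (subst complex_mod_cnj[symmetric]) (simp add: mult.commute)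
  have rows: "(\<Sum>j<s. (cmod (\<alpha> i j))\<^sup>2) \<le> 1" if "i < r" for i
    using bessel_inequality[OF q, of "p i"] unit[OF p that] unfolding \<alpha>_swap by simp
  have scal: "Re (of_real x * z) = x * Re z" for x z by simp
  have AB: "Re (frob_inner A B) = (\<Sum>i<r. \<Sum>j<s. \<sigma> i * \<tau> j * Re (\<alpha> i j * cnj (\<beta> i j)))"
    unfolding frob_inner_singular_expansions[OF A B] \<alpha>_def[symmetric] \<beta>_def[symmetric] Re_sum scal ..
  have "Re (frob_inner H K) = (\<Sum>i<r. \<Sum>j<s. \<sigma> i * \<tau> j * Re (\<beta> i j * cnj (\<beta> i j)))"
    unfolding frob_inner_singular_expansions[OF H K] \<beta>_def[symmetric] Re_sum scal ..
  then have HK: "Re (frob_inner H K) = (\<Sum>i<r. \<Sum>j<s. \<sigma> i * \<tau> j * (cmod (\<beta> i j))\<^sup>2)"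
    by (simp only: complex_norm_square[symmetric] Re_complex_of_real)
  have "2 * c * Re (frob_inner A B) = (\<Sum>i<r. \<Sum>j<s. \<sigma> i * \<tau> j * (2 * c * Re (\<alpha> i j * cnj (\<beta> i j))))"
    unfolding AB sum_distrib_left by (intro sum.cong refl) (simp only: mult_ac)
  also have "\<dots> \<le> (\<Sum>i<r. \<Sum>j<s. \<sigma> i * \<tau> j * (2 * (cmod (\<beta> i j))\<^sup>2 + c\<^sup>2 / 2 * (cmod (\<alpha> i j))\<^sup>2))"
    using \<sigma>0 \<tau>0 by (intro sum_mono mult_left_mono weighted_am_gm_complex c) auto
  also have "\<dots> = 2 * Re (frob_inner H K) + c\<^sup>2 / 2 * (\<Sum>i<r. \<Sum>j<s. \<sigma> i * \<tau> j * (cmod (\<alpha> i j))\<^sup>2)"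
    unfolding HK sum_distrib_left sum.distrib[symmetric] by (intro sum.cong refl) (simp add: algebra_simps)
  also have "(\<Sum>i<r. \<Sum>j<s. \<sigma> i * \<tau> j * (cmod (\<alpha> i j))\<^sup>2) \<le> (\<Sum>i<r. \<sigma> i * \<tau> i)"
    by (rule substochastic_weighted_sum_le[OF rs \<sigma>0 \<sigma> \<tau>0 \<tau> _ rows cols]) auto
  finally show ?thesis by (simp add: mult_left_mono)
qed

section \<open>Polar decompositions with prescribed singular values\<close>

lemma mat_adjoint_one [simp]: "mat_adjoint (1\<^sub>m n) = (1\<^sub>m n :: complex mat)"
  by (rule eq_matI) auto

lemma unitary_mat_one: "unitary_mat n (1\<^sub>m n)"
  by (simp add: unitary_mat_def)

lemma adjoint_inner_product:
  fixes A :: "complex mat"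
  assumes A: "A \<in> carrier_mat m n" and y: "y \<in> carrier_vec n" and x: "x \<in> carrier_vec m"
  shows "(A *\<^sub>v y) \<bullet>c x = y \<bullet>c (mat_adjoint A *\<^sub>v x)"
proof -
  have "(A *\<^sub>v y) \<bullet>c x = (\<Sum>a<m. (A *\<^sub>v y) $ a * cnj (x $ a))"
    using A x by (auto simp: scalar_prod_def lessThan_atLeast0 intro!: sum.cong)
  also have "\<dots> = (\<Sum>a<m. \<Sum>l<n. A $$ (a, l) * y $ l * cnj (x $ a))"
    by (intro sum.cong refl) (simp only: lessThan_iff index_mult_mat_vec_sum[OF A y] sum_distrib_right)
  also have "\<dots> = (\<Sum>l<n. \<Sum>a<m. A $$ (a, l) * y $ l * cnj (x $ a))"
    by (rule sum.swap)
  also have "\<dots> = (\<Sum>l<n. y $ l * cnj ((mat_adjoint A *\<^sub>v x) $ l))"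
  proof (intro sum.cong refl)
    fix l assume "l \<in> {..<n}"
    then have l: "l < n" by simp
    have "(mat_adjoint A *\<^sub>v x) $ l = (\<Sum>a<m. mat_adjoint A $$ (l, a) * x $ a)"
      by (rule index_mult_mat_vec_sum) (use A x l in auto)
    also have "\<dots> = (\<Sum>a<m. cnj (A $$ (a, l)) * x $ a)"
      using A l by (intro sum.cong) auto
    finally show "(\<Sum>a<m. A $$ (a, l) * y $ l * cnj (x $ a)) = y $ l * cnj ((mat_adjoint A *\<^sub>v x) $ l)"
      by (simp add: sum_distrib_left mult_ac)
  qed
  also have "\<dots> = y \<bullet>c (mat_adjoint A *\<^sub>v x)"
    using A x by (auto simp: scalar_prod_def lessThan_atLeast0 intro!: sum.cong)
  finally show ?thesis .
qed

lemma unitary_mult_vec_cancel: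
  assumes V: "unitary_mat n V" and z: "z \<in> carrier_vec n"
  shows "mat_adjoint V *\<^sub>v (V *\<^sub>v z) = z"
proof -
  have "mat_adjoint V *\<^sub>v (V *\<^sub>v z) = (mat_adjoint V * V) *\<^sub>v z"
    by (rule assoc_mult_mat_vec[symmetric, of _ n n _ n]) (use unitary_matD(1)[OF V] z in auto)
  then show ?thesis using unitary_matD(2)[OF V] z by simp
qed

lemma pos_semidef_unitary_conjugate_diagonal:
  assumes V: "unitary_mat n V" and f: "\<And>i. i < n \<Longrightarrow> 0 \<le> f i"
  shows "pos_semidef (V * diagonal n (\<lambda>i. of_real (f i)) * mat_adjoint V)"
proof -
  define D where "D = diagonal n (\<lambda>i. complex_of_real (f i))"
  have Dc: "D \<in> carrier_mat n n" and Dadj: "mat_adjoint D = D"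
    by (auto simp: D_def mat_adjoint_diagonal)
  note Vc = unitary_matD(1)[OF V]
  have c: "V * D * mat_adjoint V \<in> carrier_mat n n" using Vc Dc by simp
  have "mat_adjoint (V * D * mat_adjoint V) = V * D * mat_adjoint V"
    using hermitian_conjugate[OF Dc Dadj, of "mat_adjoint V"] Vc by simp
  moreover have "0 \<le> Re ((V * D * mat_adjoint V *\<^sub>v x) \<bullet>c x)" if x: "x \<in> carrier_vec n" for x
  proof -
    define y where "y = mat_adjoint V *\<^sub>v x"
    have y: "y \<in> carrier_vec n" unfolding y_def using Vc x by (intro mult_mat_vec_carrier[of _ n n]) auto
    have Dy: "D *\<^sub>v y \<in> carrier_vec n" using Dc y by (rule mult_mat_vec_carrier)
    have "V * D * mat_adjoint V *\<^sub>v x = (V * D) *\<^sub>v y"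
      unfolding y_def by (rule assoc_mult_mat_vec[of _ n n _ n]) (use Vc Dc x in auto)
    also have "\<dots> = V *\<^sub>v (D *\<^sub>v y)" using Vc Dc y by (rule assoc_mult_mat_vec)
    finally have "(V * D * mat_adjoint V *\<^sub>v x) \<bullet>c x = (D *\<^sub>v y) \<bullet>c y"
      using adjoint_inner_product[OF Vc Dy x] unfolding y_def by simp
    also have "\<dots> = (\<Sum>i<n. (D *\<^sub>v y) $ i * cnj (y $ i))"
      using y by (auto simp: scalar_prod_def lessThan_atLeast0 intro!: sum.cong)
    also have "\<dots> = of_real (\<Sum>i<n. f i * (cmod (y $ i))\<^sup>2)"
      unfolding of_real_sum of_real_mult complex_norm_square
      by (intro sum.cong refl) (simp only: lessThan_iff D_def index_diagonal_mult_vec[OF y] mult.assoc)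
    finally show ?thesis using f by (auto intro!: sum_nonneg)
  qed
  ultimately show ?thesis using c unfolding pos_semidef_def D_def by auto
qed

text \<open>Since \<^term>\<open>J\<close> is the projection onto the support of the diagonal matrix \<^term>\<open>D\<close>, the two factors
multiply to \<open>J V\<^sup>* V D V\<^sup>* = D V\<^sup>*\<close>, and both ranges are spanned by the first columns of
\<^term>\<open>V\<close>.\<close>

lemma gen_polar_decomp_diagonal_mult_unitary:
  assumes V: "unitary_mat n V" and k: "k \<le> n"
    and pos: "\<And>i. i < k \<Longrightarrow> 0 < f i" and zero: "\<And>i. k \<le> i \<Longrightarrow> i < n \<Longrightarrow> f i = 0"
    and dec: "\<And>i j. i \<le> j \<Longrightarrow> j < n \<Longrightarrow> f j \<le> f i"
  defines "D \<equiv> diagonal n (\<lambda>i. complex_of_real (f i))"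
    and "J \<equiv> diagonal n (\<lambda>i. if i < k then 1 else 0)"
  shows "gen_polar_decomp k n n (D * mat_adjoint V) (J * mat_adjoint V) (V * D * mat_adjoint V)"
    and "sing_vals (D * mat_adjoint V) = map f [0..<k]"
    and "D * mat_adjoint V \<in> rank_carrier_mat k n n"
proof -
  note Vc = unitary_matD(1)[OF V]
  have Dc: "D \<in> carrier_mat n n" and Jc: "J \<in> carrier_mat n n" by (auto simp: D_def J_def)
  have Jadj: "mat_adjoint J = J" and Dadj: "mat_adjoint D = D"
    by (auto simp: J_def D_def mat_adjoint_diagonal intro!: diagonal_cong)
  have suppD: "(of_real (f i) :: complex) \<noteq> 0 \<longleftrightarrow> i < k" if "i < n" for i
    using pos[of i] zero[of i] that by (cases "i < k") auto
  have suppJ: "(if i < k then 1 else 0 :: complex) \<noteq> 0 \<longleftrightarrow> i < k" for i by simp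
  have rk: "vec_space.rank n (D * mat_adjoint V) = k" "vec_space.rank n (J * mat_adjoint V) = k"
    using rank_unitary_diagonal_unitary[OF unitary_mat_one V k suppD]
      rank_unitary_diagonal_unitary[OF unitary_mat_one V k suppJ]
    by (simp_all add: D_def J_def left_mult_one_mat[OF diagonal_carrier])
  show "D * mat_adjoint V \<in> rank_carrier_mat k n n"
    using rk Dc Vc by (simp add: rank_carrier_mat_def)
  have adjM: "mat_adjoint (X * mat_adjoint V) = V * mat_adjoint X" if "X \<in> carrier_mat n n" for X
    using mat_adjoint_mult[of X n n "mat_adjoint V" n] that Vc by simp
  have assoc: "X * mat_adjoint V * (V * Y) = X * Y" if "X \<in> carrier_mat n n" "Y \<in> carrier_mat n n" for X Y
  proof -
    have "X * mat_adjoint V * (V * Y) = X * ((mat_adjoint V * V) * Y)"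
      using that Vc by (simp add: assoc_mult_mat[of _ n n _ n _ n])
    then show ?thesis using that unitary_matD(2)[OF V] by simp
  qed
  have JD: "J * D = D" unfolding J_def D_def diagonal_mult_diagonal
    using zero by (intro diagonal_cong) auto
  have csH: "vec_space.col_space n (V * D * mat_adjoint V) = (\<lambda>z. V *\<^sub>v z) ` coord_subspace n k"
    unfolding D_def by (rule col_space_mult_coord_subspace[OF Vc V suppD])
  have csQ: "vec_space.col_space n (mat_adjoint (J * mat_adjoint V)) = (\<lambda>z. V *\<^sub>v z) ` coord_subspace n k"
    using col_space_mult_coord_subspace[OF Vc unitary_mat_one suppJ] adjM[OF Jc] Jadj Vc
    by (simp add: J_def right_mult_one_mat[OF square_mult_carrier[OF Vc diagonal_carrier]])
  have "subunitary (J * mat_adjoint V)"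
    unfolding subunitary_def
  proof
    fix x assume "x \<in> vec_space.col_space (dim_col (J * mat_adjoint V)) (mat_adjoint (J * mat_adjoint V))"
    then obtain z where z: "z \<in> coord_subspace n k" and x: "x = V *\<^sub>v z"
      using csQ Vc by auto
    have zc: "z \<in> carrier_vec n" using z by (simp add: coord_subspace_def)
    have xc: "x \<in> carrier_vec n" unfolding x using Vc zc by (rule mult_mat_vec_carrier)
    have "J * mat_adjoint V *\<^sub>v x = J *\<^sub>v (mat_adjoint V *\<^sub>v x)"
      by (rule assoc_mult_mat_vec[of _ n n _ n]) (use Jc Vc xc in auto)
    also have "\<dots> = J *\<^sub>v z" unfolding x unitary_mult_vec_cancel[OF V zc] ..
    also have "\<dots> = z"
    proof (rule eq_vecI)
      fix i assume "i < dim_vec z"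
      then have i: "i < n" using zc by simp
      show "(J *\<^sub>v z) $ i = z $ i"
        unfolding J_def index_diagonal_mult_vec[OF zc i] using z i by (auto simp: coord_subspace_def)
    qed (use Jc zc in auto)
    finally have "J * mat_adjoint V *\<^sub>v x = z" .
    moreover have "x \<bullet>c x = z \<bullet>c z"
      using adjoint_inner_product[OF Vc zc xc] unitary_mult_vec_cancel[OF V zc] by (simp add: x)
    ultimately show "(J * mat_adjoint V *\<^sub>v x) \<bullet>c (J * mat_adjoint V *\<^sub>v x) = x \<bullet>c x" by simp
  qed
  moreover have "pos_semidef (V * D * mat_adjoint V)"
    unfolding D_def
  proof (rule pos_semidef_unitary_conjugate_diagonal[OF V])
    fix i assume "i < n"
    then show "0 \<le> f i" using pos[of i] zero[of i] by (cases "i < k") auto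
  qed
  moreover have "vec_space.rank n (V * D * mat_adjoint V) = k"
    unfolding D_def by (rule rank_unitary_diagonal_unitary[OF V V k suppD])
  then have "V * D * mat_adjoint V \<in> rank_carrier_mat k n n"
    using Vc Dc by (simp add: rank_carrier_mat_def)
  moreover have "J * mat_adjoint V \<in> rank_carrier_mat k n n"
    using rk Jc Vc by (simp add: rank_carrier_mat_def)
  moreover have "D * mat_adjoint V = J * mat_adjoint V * (V * D * mat_adjoint V)"
  proof -
    have "J * mat_adjoint V * (V * D * mat_adjoint V) = J * mat_adjoint V * (V * (D * mat_adjoint V))"
      using Vc Dc by (simp add: assoc_mult_mat[of V n n D n _ n])
    also have "\<dots> = J * (D * mat_adjoint V)" by (rule assoc) (use Jc Dc Vc in auto)
    also have "\<dots> = (J * D) * mat_adjoint V"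
      using Jc Dc Vc by (simp add: assoc_mult_mat[of J n n D n _ n])
    finally show ?thesis unfolding JD ..
  qed
  ultimately show "gen_polar_decomp k n n (D * mat_adjoint V) (J * mat_adjoint V) (V * D * mat_adjoint V)"
    unfolding gen_polar_decomp_def csQ csH by blast
  have "mat_adjoint (D * mat_adjoint V) * (D * mat_adjoint V) = V * (D * D) * mat_adjoint V"
    unfolding adjM[OF Dc] Dadj using Dc Vc by (simp add: assoc_mult_mat[of _ n n _ n _ n])
  also have "D * D = diagonal n (\<lambda>i. of_real ((f i)\<^sup>2))"
    unfolding D_def diagonal_mult_diagonal by (rule diagonal_cong) (simp add: power2_eq_square)
  finally show "sing_vals (D * mat_adjoint V) = map f [0..<k]"
    by (rule sing_vals_of_gram[OF V k]) (fact pos zero dec)+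
qed

text \<open>The rotation that turns each coordinate \<open>i\<close> below \<^term>\<open>s\<close> by the angle with cosine \<^term>\<open>t\<close> in the
plane that it spans with coordinate \<open>i + s\<close>.\<close>

definition rotation_mat :: "nat \<Rightarrow> real \<Rightarrow> complex mat" where
  "rotation_mat s t = four_block_mat
     (diagonal s (\<lambda>_. of_real t)) (diagonal s (\<lambda>_. of_real (sqrt (1 - t\<^sup>2))))
     (diagonal s (\<lambda>_. of_real (- sqrt (1 - t\<^sup>2)))) (diagonal s (\<lambda>_. of_real t))"

lemma diagonal_add: "diagonal n f + diagonal n g = diagonal n (\<lambda>i. f i + g i)"
  by (rule eq_matI) auto

lemma rotation_mat_unitary:
  assumes "0 \<le> t" "t \<le> 1"
  shows "unitary_mat (s + s) (rotation_mat s t)"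
proof -
  define u where "u = sqrt (1 - t\<^sup>2)"
  have tu: "t * t + u * u = 1"
    using assms unfolding u_def by (simp add: power2_eq_square[symmetric] power_le_one)
  have tuc: "complex_of_real t * of_real t + of_real u * of_real u = 1"
    using arg_cong[OF tu, of complex_of_real] by simp
  have c: "rotation_mat s t \<in> carrier_mat (s + s) (s + s)"
    unfolding rotation_mat_def by (rule four_block_carrier_mat) auto
  have adj: "mat_adjoint (rotation_mat s t) = four_block_mat
     (diagonal s (\<lambda>_. of_real t)) (diagonal s (\<lambda>_. of_real (- u)))
     (diagonal s (\<lambda>_. of_real u)) (diagonal s (\<lambda>_. of_real t))"
    by (rule eq_matI) (auto simp: rotation_mat_def u_def four_block_mat_def Let_def)
  have "mat_adjoint (rotation_mat s t) * rotation_mat s t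
      = four_block_mat (diagonal s (\<lambda>_. 1)) (diagonal s (\<lambda>_. 0)) (diagonal s (\<lambda>_. 0)) (diagonal s (\<lambda>_. 1))"
    unfolding adj unfolding rotation_mat_def u_def[symmetric]
    by (subst mult_four_block_mat[where ?nr1.0 = s and ?n1.0 = s and ?n2.0 = s and ?nr2.0 = s and ?nc1.0 = s and ?nc2.0 = s])
      (use tuc in \<open>auto simp: diagonal_mult_diagonal diagonal_add add.commute mult.commute\<close>)
  also have "\<dots> = 1\<^sub>m (s + s)"
    by (rule eq_matI) (auto simp: four_block_mat_def Let_def)
  finally show ?thesis using c by (simp add: unitary_mat_def)
qed

section \<open>Optimality\<close>

lemma frob_inner_diagonal:
  assumes B: "B \<in> carrier_mat n n"
  shows "frob_inner (diagonal n f) B = (\<Sum>a<n. f a * cnj (B $$ (a, a)))"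
proof -
  have "frob_inner (diagonal n f) B = (\<Sum>a<n. \<Sum>b<n. if b = a then f a * cnj (B $$ (a, b)) else 0)"
    unfolding frob_inner_def dim_diagonal by (intro sum.cong refl) auto
  then show ?thesis by simp
qed

text \<open>The two matrices have the same left singular vectors, and each pair of right singular vectors with equal index spans
the same angle, with cosine \<^term>\<open>t\<close>, while all others are orthogonal. Then each pair
contributes the factor \<^term>\<open>t\<close> to the inner product of the matrices and \<^term>\<open>t\<^sup>2\<close> to that of the
positive factors. The dimension is doubled to make room for the rotated vectors.\<close>

lemma extremal_pair:
  fixes \<sigma> \<tau> :: "nat \<Rightarrow> real"
  assumes rs: "r \<le> s"
    and \<sigma>0: "\<And>i. i < r \<Longrightarrow> 0 < \<sigma> i" and \<sigma>: "\<And>i j. i \<le> j \<Longrightarrow> j < r \<Longrightarrow> \<sigma> j \<le> \<sigma> i"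
    and \<tau>0: "\<And>i. i < s \<Longrightarrow> 0 < \<tau> i" and \<tau>: "\<And>i j. i \<le> j \<Longrightarrow> j < s \<Longrightarrow> \<tau> j \<le> \<tau> i"
    and t: "0 \<le> t" "t \<le> 1"
  shows "\<exists>N A Q H B Qt Ht. A \<in> rank_carrier_mat r N N \<and> B \<in> rank_carrier_mat s N N
    \<and> gen_polar_decomp r N N A Q H \<and> gen_polar_decomp s N N B Qt Ht
    \<and> sing_vals A = map \<sigma> [0..<r] \<and> sing_vals B = map \<tau> [0..<s]
    \<and> Re (frob_inner A B) = t * (\<Sum>i<r. \<sigma> i * \<tau> i)
    \<and> Re (frob_inner H Ht) = t\<^sup>2 * (\<Sum>i<r. \<sigma> i * \<tau> i)"
proof -
  define N where "N = s + s"
  define f where "f i = (if i < r then \<sigma> i else 0)" for i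
  define g where "g i = (if i < s then \<tau> i else 0)" for i
  define R where "R = rotation_mat s t"
  define Df where "Df = diagonal N (\<lambda>i. complex_of_real (f i))"
  define Dg where "Dg = diagonal N (\<lambda>i. complex_of_real (g i))"
  define J where "J k = diagonal N (\<lambda>i. if i < k then 1 else (0 :: complex))" for k
  have R: "unitary_mat N R" unfolding N_def R_def using t by (rule rotation_mat_unitary)
  note Rc = unitary_matD(1)[OF R]
  have rN: "r \<le> N" and sN: "s \<le> N" using rs by (auto simp: N_def)
  have fdec: "f j \<le> f i" if "i \<le> j" for i j
    using \<sigma>[OF that] \<sigma>0[of i] that by (auto simp: f_def less_imp_le)
  have gdec: "g j \<le> g i" if "i \<le> j" for i j
    using \<tau>[OF that] \<tau>0[of i] that by (auto simp: g_def less_imp_le)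
  have Dfc: "Df \<in> carrier_mat N N" and Dgc: "Dg \<in> carrier_mat N N" by (auto simp: Df_def Dg_def)
  have A: "gen_polar_decomp r N N Df (J r) Df" "sing_vals Df = map f [0..<r]" "Df \<in> rank_carrier_mat r N N"
    using gen_polar_decomp_diagonal_mult_unitary[OF unitary_mat_one rN, of f] \<sigma>0 fdec
    unfolding Df_def[symmetric] J_def[symmetric]
    by (auto simp: f_def left_mult_one_mat[OF Dfc] right_mult_one_mat[OF Dfc]
        right_mult_one_mat[OF diagonal_carrier] J_def)
  have B: "gen_polar_decomp s N N (Dg * mat_adjoint R) (J s * mat_adjoint R) (R * Dg * mat_adjoint R)"
    "sing_vals (Dg * mat_adjoint R) = map g [0..<s]" "Dg * mat_adjoint R \<in> rank_carrier_mat s N N"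
    using gen_polar_decomp_diagonal_mult_unitary[OF R sN, of g] \<tau>0 gdec
    unfolding Dg_def[symmetric] J_def[symmetric] by (auto simp: g_def)
  have Rd: "R $$ (a, i) = (if a = i then of_real t else 0)" if "a < s" "i < s" for a i
    using that by (auto simp: R_def rotation_mat_def four_block_mat_def Let_def)
  have "frob_inner Df (Dg * mat_adjoint R) = (\<Sum>a<N. of_real (f a) * cnj ((Dg * mat_adjoint R) $$ (a, a)))"
    unfolding Df_def by (rule frob_inner_diagonal) (use Dgc Rc in simp)
  also have "\<dots> = (\<Sum>a<N. of_real (f a) * (of_real (g a) * R $$ (a, a)))"
    using Rc by (intro sum.cong refl) (simp add: Dg_def index_diagonal_mult[of _ N N] del: index_mult_mat(1))
  also have "\<dots> = (\<Sum>a<r. of_real (\<sigma> a) * (of_real (\<tau> a) * of_real t))"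
    using rs rN by (intro sum.mono_neutral_cong_right) (auto simp: f_def g_def Rd)
  also have "\<dots> = of_real (t * (\<Sum>i<r. \<sigma> i * \<tau> i))"
    by (simp add: sum_distrib_left mult_ac)
  finally have AB: "Re (frob_inner Df (Dg * mat_adjoint R)) = t * (\<Sum>i<r. \<sigma> i * \<tau> i)"
    by (simp only: Re_complex_of_real)
  have entry: "(R * Dg * mat_adjoint R) $$ (a, a) = of_real (t\<^sup>2 * \<tau> a)" if a: "a < s" for a
  proof -
    have aN: "a < N" using a sN by simp
    have "(R * Dg * mat_adjoint R) $$ (a, a) = (\<Sum>i<N. (R * Dg) $$ (a, i) * mat_adjoint R $$ (i, a))"
      by (rule index_mult_mat_sum[of _ N N _ N]) (use Rc Dgc aN in auto)
    also have "\<dots> = (\<Sum>i<N. R $$ (a, i) * of_real (g i) * cnj (R $$ (a, i)))"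
      using Rc aN by (intro sum.cong refl) (simp add: Dg_def index_mult_diagonal[OF Rc] del: index_mult_mat(1))
    also have "\<dots> = (\<Sum>i<s. if i = a then of_real (t\<^sup>2 * \<tau> a) else 0)"
      using a sN by (intro sum.mono_neutral_cong_right) (auto simp: g_def Rd power2_eq_square)
    finally show ?thesis using a by simp
  qed
  have "frob_inner Df (R * Dg * mat_adjoint R) = (\<Sum>a<N. of_real (f a) * cnj ((R * Dg * mat_adjoint R) $$ (a, a)))"
    unfolding Df_def by (rule frob_inner_diagonal) (use Dgc Rc in simp)
  also have "\<dots> = (\<Sum>a<r. of_real (\<sigma> a * (t\<^sup>2 * \<tau> a)))"
    using rs rN by (intro sum.mono_neutral_cong_right) (auto simp: f_def entry simp del: index_mult_mat(1))
  also have "\<dots> = of_real (t\<^sup>2 * (\<Sum>i<r. \<sigma> i * \<tau> i))"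
    by (simp add: sum_distrib_left mult_ac)
  finally have HK: "Re (frob_inner Df (R * Dg * mat_adjoint R)) = t\<^sup>2 * (\<Sum>i<r. \<sigma> i * \<tau> i)"
    by (simp only: Re_complex_of_real)
  have "map f [0..<r] = map \<sigma> [0..<r]" "map g [0..<s] = map \<tau> [0..<s]"
    by (auto simp: f_def g_def)
  then show ?thesis using A B AB HK by metis
qed

lemma frob_norms_of_polar_factors:
  assumes "gen_polar_decomp r m n A Q H"
  shows "(frob_norm A)\<^sup>2 = (\<Sum>j<r. (sing_vals A ! j)\<^sup>2)" "(frob_norm H)\<^sup>2 = (\<Sum>j<r. (sing_vals A ! j)\<^sup>2)"
    "A \<in> carrier_mat m n" "H \<in> carrier_mat n n"
proof -
  obtain \<sigma> p u where "sing_vals A = map \<sigma> [0..<r]" "singular_expansion m n r \<sigma> p u A"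
    "singular_expansion n n r \<sigma> u u H"
    using gen_polar_decomp_expansion[OF assms] by blast
  then show "(frob_norm A)\<^sup>2 = (\<Sum>j<r. (sing_vals A ! j)\<^sup>2)" "(frob_norm H)\<^sup>2 = (\<Sum>j<r. (sing_vals A ! j)\<^sup>2)"
    "A \<in> carrier_mat m n" "H \<in> carrier_mat n n"
    by (auto simp: frob_norm_singular_expansion singular_expansion_def)
qed

lemma frob_norm_nonneg: "0 \<le> frob_norm A"
  unfolding frob_norm_def by (intro real_sqrt_ge_zero sum_nonneg) auto

theorem theorem1p4:
  fixes m n r s :: nat
    and A E Q H Qt Ht :: "complex mat"
  assumes "0 < r" and "r \<le> s"
    and "A \<in> rank_carrier_mat r m n"
    and "E \<in> carrier_mat m n"
    and "A + E \<in> rank_carrier_mat s m n"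
    and "gen_polar_decomp r m n A Q H"
    and "gen_polar_decomp s m n (A + E) Qt Ht"
  shows "frob_norm (H - Ht) \<le> polar_coeff r s A (A + E) * frob_norm E
    \<and> (\<forall>K::real.
         (\<forall>m' n' A' E' Q' H' Qt' Ht'.
            A' \<in> rank_carrier_mat r m' n' \<longrightarrow>
            E' \<in> carrier_mat m' n' \<longrightarrow>
            A' + E' \<in> rank_carrier_mat s m' n' \<longrightarrow>
            sing_vals A' = sing_vals A \<longrightarrow>
            sing_vals (A' + E') = sing_vals (A + E) \<longrightarrow>
            gen_polar_decomp r m' n' A' Q' H' \<longrightarrow>
            gen_polar_decomp s m' n' (A' + E') Qt' Ht' \<longrightarrow>
            frob_norm (H' - Ht') \<le> K * frob_norm E')
         \<longrightarrow> polar_coeff r s A (A + E) \<le> K)"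
proof -
  define B where "B = A + E"
  define F where "F = F_sum r s A B"
  define G where "G = G_sum r A B"
  define c where "c = (F - sqrt (F\<^sup>2 - 2 * G * F)) / G"
  have pc: "polar_coeff r s A B = sqrt c"
    by (simp add: polar_coeff_def c_def F_def G_def B_def)
  note gA = assms(6) and gB = assms(7)[folded B_def]
  from gen_polar_decomp_expansion[OF gA] obtain \<sigma> p u where svA: "sing_vals A = map \<sigma> [0..<r]"
    and \<sigma>: "\<forall>i<r. 0 < \<sigma> i" "\<forall>i j. i \<le> j \<longrightarrow> j < r \<longrightarrow> \<sigma> j \<le> \<sigma> i"
    and eA: "singular_expansion m n r \<sigma> p u A" and eH: "singular_expansion n n r \<sigma> u u H"
    by (elim exE conjE)
  from gen_polar_decomp_expansion[OF gB] obtain \<tau> q v where svB: "sing_vals B = map \<tau> [0..<s]"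
    and \<tau>: "\<forall>i<s. 0 < \<tau> i" "\<forall>i j. i \<le> j \<longrightarrow> j < s \<longrightarrow> \<tau> j \<le> \<tau> i"
    and eB: "singular_expansion m n s \<tau> q v B" and eHt: "singular_expansion n n s \<tau> v v Ht"
    by (elim exE conjE)
  have Geq: "G = (\<Sum>i<r. \<sigma> i * \<tau> i)"
    unfolding G_def G_sum_def svA svB using assms(2) by (intro sum.cong) auto
  have Gpos: "0 < G" unfolding Geq using \<sigma> \<tau> assms(1,2) by (intro sum_pos) auto
  have Feq: "F = (\<Sum>i<r. (\<sigma> i)\<^sup>2) + (\<Sum>i<s. (\<tau> i)\<^sup>2)"
    unfolding F_def F_sum_def svA svB by simp
  have FG: "2 * G \<le> F"
  proof -
    have "2 * G \<le> (\<Sum>i<r. (\<sigma> i)\<^sup>2 + (\<tau> i)\<^sup>2)"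
      unfolding Geq sum_distrib_left
      by (intro sum_mono) (use sum_squares_bound in \<open>simp add: mult.assoc\<close>)
    also have "\<dots> \<le> F" unfolding Feq sum.distrib using assms(2) by (intro add_left_mono sum_mono2) auto
    finally show ?thesis .
  qed
  note c = polar_coeff_root[OF Gpos FG, folded c_def]
  have diff: "(frob_norm (X - Y))\<^sup>2 = F - 2 * Re (frob_inner X Y)"
    if "X \<in> carrier_mat k l" "Y \<in> carrier_mat k l" "(frob_norm X)\<^sup>2 = (\<Sum>j<r. (sing_vals A ! j)\<^sup>2)"
      "(frob_norm Y)\<^sup>2 = (\<Sum>j<s. (sing_vals B ! j)\<^sup>2)" for X Y k l
    using frob_norm_diff_squared[OF that(1,2)] that(3,4) by (simp add: F_def F_sum_def)
  note nA = frob_norms_of_polar_factors[OF gA] and nB = frob_norms_of_polar_factors[OF gB]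
  have "E = B - A" unfolding B_def by (rule eq_matI) (use nA(3) assms(4) in auto)
  then have normE: "(frob_norm E)\<^sup>2 = F - 2 * Re (frob_inner A B)"
    using diff[OF nA(3) nB(3) nA(1) nB(1)] frob_norm_minus_commute[OF nA(3) nB(3)] by simp
  have normH: "(frob_norm (H - Ht))\<^sup>2 = F - 2 * Re (frob_inner H Ht)"
    by (rule diff[OF nA(4) nB(4) nA(2) nB(2)])
  have "2 * c * Re (frob_inner A B) \<le> 2 * Re (frob_inner H Ht) + c\<^sup>2 / 2 * G"
    unfolding Geq using \<sigma> \<tau> c(2)
    by (intro inner_products_trade_off[OF assms(2) _ eA eH eB eHt]) (auto simp: less_imp_le)
  then have "(frob_norm (H - Ht))\<^sup>2 \<le> c * (frob_norm E)\<^sup>2"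
    unfolding normH normE using c(1) by (simp add: algebra_simps)
  also have "\<dots> = (sqrt c * frob_norm E)\<^sup>2" using c(2) by (simp add: power_mult_distrib)
  finally have bound: "frob_norm (H - Ht) \<le> sqrt c * frob_norm E"
    by (rule power2_le_imp_le) (use c(2) frob_norm_nonneg in auto)
  have optimal: "sqrt c \<le> K"
    if K: "\<forall>m' n' A' E' Q' H' Qt' Ht'.
            A' \<in> rank_carrier_mat r m' n' \<longrightarrow> E' \<in> carrier_mat m' n' \<longrightarrow>
            A' + E' \<in> rank_carrier_mat s m' n' \<longrightarrow> sing_vals A' = sing_vals A \<longrightarrow>
            sing_vals (A' + E') = sing_vals B \<longrightarrow> gen_polar_decomp r m' n' A' Q' H' \<longrightarrow>
            gen_polar_decomp s m' n' (A' + E') Qt' Ht' \<longrightarrow>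
            frob_norm (H' - Ht') \<le> K * frob_norm E'" for K
  proof -
    have ex: "\<exists>h e. 0 \<le> h \<and> 0 \<le> e \<and> h\<^sup>2 = F - 2 * (t\<^sup>2 * G) \<and> e\<^sup>2 = F - 2 * (t * G) \<and> h \<le> K * e"
      if t: "0 \<le> t" "t \<le> 1" for t
    proof -
      obtain N A' Q' H' B' Qt' Ht' where A': "A' \<in> rank_carrier_mat r N N" and B': "B' \<in> rank_carrier_mat s N N"
        and gA': "gen_polar_decomp r N N A' Q' H'" and gB': "gen_polar_decomp s N N B' Qt' Ht'"
        and sv: "sing_vals A' = sing_vals A" "sing_vals B' = sing_vals B"
        and ip: "Re (frob_inner A' B') = t * G" "Re (frob_inner H' Ht') = t\<^sup>2 * G"
        using extremal_pair[of r s \<sigma> \<tau> t] assms(2) \<sigma> \<tau> t unfolding svA svB Geq by auto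
      note nA' = frob_norms_of_polar_factors[OF gA', unfolded sv]
        and nB' = frob_norms_of_polar_factors[OF gB', unfolded sv]
      define E' where "E' = B' - A'"
      have E'c: "E' \<in> carrier_mat N N" using nA'(3) nB'(3) by (auto simp: E'_def)
      have AE: "A' + E' = B'" unfolding E'_def by (rule eq_matI) (use nA'(3) nB'(3) in auto)
      have "frob_norm (H' - Ht') \<le> K * frob_norm E'"
        using K A' E'c B' sv gA' gB' AE by metis
      moreover have "(frob_norm (H' - Ht'))\<^sup>2 = F - 2 * (t\<^sup>2 * G)"
        using diff[OF nA'(4) nB'(4) nA'(2) nB'(2)] ip by simp
      moreover have "(frob_norm E')\<^sup>2 = F - 2 * (t * G)"
        using diff[OF nA'(3) nB'(3) nA'(1) nB'(1)] ip frob_norm_minus_commute[OF nA'(3) nB'(3)]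
        by (simp add: E'_def)
      ultimately show ?thesis using frob_norm_nonneg by blast
    qed
    \<comment> \<open>The orthogonal configuration, with t = 0, shows that K is positive.\<close>
    have K0: "0 < K"
    proof -
      obtain h e where "0 \<le> h" "0 \<le> e" "h\<^sup>2 = F" "h \<le> K * e" using ex[of 0] by auto
      moreover have "h \<noteq> 0" using \<open>h\<^sup>2 = F\<close> Gpos FG by auto
      ultimately show ?thesis by (metis less_le_trans mult_nonpos_nonneg not_less order_le_less)
    qed
    have ineq: "F - 2 * (t\<^sup>2 * G) \<le> K\<^sup>2 * (F - 2 * (t * G))" if t: "0 \<le> t" "t \<le> 1" for t
    proof -
      obtain h e where he: "0 \<le> h" "h\<^sup>2 = F - 2 * (t\<^sup>2 * G)" "e\<^sup>2 = F - 2 * (t * G)" "h \<le> K * e"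
        using ex[OF t] by blast
      have "h\<^sup>2 \<le> (K * e)\<^sup>2" using he(1,4) by (intro power_mono)
      then show ?thesis using he(2,3) by (simp add: power_mult_distrib)
    qed
    have "c \<le> K\<^sup>2"
    proof (cases "c = 2")
      case False
      then have c2: "c < 2" using c(3) by simp
      \<comment> \<open>The choice t = c / 2 is the case of equality in the upper bound.\<close>
      have "c * (F - c * G) = F - 2 * ((c / 2)\<^sup>2 * G)"
        using c(1) by (simp add: power2_eq_square algebra_simps)
      also have "\<dots> \<le> K\<^sup>2 * (F - c * G)"
        using ineq[of "c / 2"] c(2) c2 by simp
      finally have "c * (F - c * G) \<le> K\<^sup>2 * (F - c * G)" .
      moreover have "0 < F - c * G"
        using mult_strict_right_mono[OF c2 Gpos] FG by simp
      ultimately show ?thesis by (simp add: mult_le_cancel_right)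
    next
      case True
      \<comment> \<open>Here the extremal t would be 1, where both norms vanish, so t only approaches 1.\<close>
      have F: "F = 2 * G" by (rule c(4)[OF True])
      show ?thesis
      proof (rule ccontr)
        assume "\<not> c \<le> K\<^sup>2"
        then have less: "K\<^sup>2 / 2 < 1" using True by simp
        define t where "t = K\<^sup>2 / 2"
        have "(2 * G * (1 - t)) * (1 + t) \<le> (2 * G * (1 - t)) * (2 * t)"
          using ineq[of t] less unfolding F by (simp add: t_def power2_eq_square algebra_simps)
        moreover have "0 < 2 * G * (1 - t)" using Gpos less by (simp add: t_def)
        ultimately have "1 + t \<le> 2 * t" by (simp only: mult_le_cancel_left_pos)
        then show False using less by (simp add: t_def)
      qed
    qed
    then show ?thesis using K0 by (intro real_le_lsqrt) auto
  qed
  show ?thesis unfolding B_def[symmetric] pc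
    by (intro conjI bound, intro allI impI, rule optimal)
qed

end
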